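(* Let $A\subset(0,2)$ and let $(K_\alpha)_{\alpha\in A}$, $K_\alpha\subset\mathcal C_\alpha$, be a family of sets of central configurations. If there exists $\delta>0$ such that $$K_\alpha\subset\mathcal C_\alpha\setminus\Delta^\delta\qquad\text{for all }\alpha\in A,$$ then there exists $\bar\alpha\in(0,2)$ such that $K_\alpha$ has the property of the asymptotic minimality for every $\alpha\in(0,\bar\alpha)\cap A$.
   Context: Fix $d\ge2$, $N\ge2$ and masses $m_1,\dots,m_N>0$. $M=\operatorname{diag}[m_1,\dots,m_N]$; $|y|^2=\langle My,y\rangle$ for $y\in\mathbb R^{Nd}$ (mass-weighted norm); $U_\alpha(x)=\sum_{i<j}m_im_j|x_i-x_j|^{-\alpha}$; $\Delta=\{x\in\mathbb R^{Nd}:\exists i\ne j,\ x_i=x_j\}$ and $\Delta^\delta$ is its open $\delta$-neighbourhood; $\Lambda=\{x\in\mathbb R^{Nd}\setminus\Delta:\sum_im_ix_i=0\}$; $\mathcal E=\{x\in\Lambda:|x|=1\}$; $\mathcal C_\alpha\subset\mathcal E$ is the set of central configurations, i.e. critical points of $U_\alpha$ restricted to $\mathcal E$. The action is $\mathcal A_\alpha(x)=\frac12\int_0^1|\dot x|^2dt+\int_0^1U_\alpha(x)\,dt$. The centre of mass is at the origin. Total one-collision solution: a map $x\in C([0,1],\mathbb R^{Nd})\cap C^2((0,1),\mathbb R^{Nd})$ with $x(t)\in\Delta$ for $t\in[0,1]$ only when $t=1$, solving $M\ddot x=\nabla U_\alpha(x)$ in the time interval before the collision, with $\mathcal A_\alpha(x)<+\infty$,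 and with all bodies colliding at $t=1$ (so $x(1)=0$). All such solutions considered are normalized by $|x(0)|=|\dot x(0)|=1$. Such an $x$ is asymptotic to $K_\alpha$ if, with $s(t)=x(t)/|x(t)|$, $\operatorname{dist}(K_\alpha,s(t))\to0$ as $t\to1$. Variations: for a given $x$, write $r=|x|$, $s=x/|x|$, $\rho=r^{(2-\alpha)/4}$. A compactly supported variation on $(a,b)\subset(0,1)$ corresponding to $x$ is a $\varphi\in H^1([0,1],\mathbb R^{Nd})$ with compact support in $(a,b)$ which, in the coordinates $(\rho,s)$, corresponds to a pair $(\zeta,v)$ with $\zeta$ a real-valued (radial) component and $v$ an angular component satisfying $v(t)\in T_{s(t)}\mathcal E$, where $T_s\mathcal E=\{v\in\mathbb R^{Nd}:\sum_im_iv_i=0,\ \langle Ms,v\rangle=0\}$; that is, $\varphi$ is the tangent vector at $x$ whose components along $\rho$ and $s$ are $\zeta$ and $v$. Asymptotic minimality: $K_\alpha\subset\mathcal C_\alpha$ has the property of the asymptotic minimality if for every total one-collision solution $x_\alpha$ asymptotic to $K_\alpha$ there exists $t_\alpha=t(x_\alpha)\in(0,1)$ such that $\mathcal A_\alpha(x_\alpha+\varphi)-\mathcal A_\alpha(x_\alpha)>0$ for every nonzero variation $\varphi$ with compact support in $(t_\alpha,1)$. *)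

theory Defs
  imports "HOL-Analysis.Analysis"
begin

text \<open>
  Configurations of \<open>N = CARD('n)\<close> bodies in \<open>\<real>\<^sup>d\<close>, \<open>d = CARD('d)\<close>, are elements of
  \<open>real ^ 'd ^ 'n\<close>; the order on \<open>'n\<close> only serves to write sums over \<open>i < j\<close>.
  On this type \<open>\<bullet>\<close>, \<open>norm\<close> and \<open>GDERIV\<close> are Euclidean.
\<close>

definition mass_mult :: "('n::finite \<Rightarrow> real) \<Rightarrow> real ^ 'd ^ 'n \<Rightarrow> real ^ 'd ^ 'n" where
  "mass_mult m y = (\<chi> i. m i *\<^sub>R (y $ i))"

definition mnorm :: "('n::finite \<Rightarrow> real) \<Rightarrow> real ^ 'd ^ 'n \<Rightarrow> real" where
  "mnorm m y = sqrt (mass_mult m y \<bullet> y)"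

definition centred :: "('n::finite \<Rightarrow> real) \<Rightarrow> real ^ 'd ^ 'n \<Rightarrow> bool" where
  "centred m x \<longleftrightarrow> (\<Sum>i\<in>UNIV. m i *\<^sub>R (x $ i)) = 0"

definition collisions :: "(real ^ 'd ^ 'n) set" where
  "collisions = {x. \<exists>i j. i \<noteq> j \<and> x $ i = x $ j}"

definition collisions_nbhd :: "('n::finite \<Rightarrow> real) \<Rightarrow> real \<Rightarrow> (real ^ 'd ^ 'n) set" where
  "collisions_nbhd m \<delta> = {x. \<exists>y\<in>collisions. mnorm m (x - y) < \<delta>}"

text \<open>As \<open>0 powr a = 0\<close>, the function \<open>potential\<close> has the intended value only off
  \<^const>\<open>collisions\<close>; \<open>epotential\<close> below is its extension by \<open>\<infinity>\<close>, which the action needs because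
  a varied path may collide on a set of positive measure.\<close>

definition potential ::
    "real \<Rightarrow> ('n::{finite,linorder} \<Rightarrow> real) \<Rightarrow> real ^ 'd ^ 'n::{finite,linorder} \<Rightarrow> real" where
  "potential \<alpha> m x =
     (\<Sum>(i, j)\<in>{(i, j). i < j}. m i * m j * norm (x $ i - x $ j) powr (- \<alpha>))"

definition epotential ::
    "real \<Rightarrow> ('n::{finite,linorder} \<Rightarrow> real) \<Rightarrow> real ^ 'd ^ 'n::{finite,linorder} \<Rightarrow> ennreal" where
  "epotential \<alpha> m x = (if x \<in> collisions then \<infinity> else ennreal (potential \<alpha> m x))"

definition config_space :: "('n::finite \<Rightarrow> real) \<Rightarrow> (real ^ 'd ^ 'n) set" where
  "config_space m = {x. x \<notin> collisions \<and> centred m x}"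

definition ellipsoid :: "('n::finite \<Rightarrow> real) \<Rightarrow> (real ^ 'd ^ 'n) set" where
  "ellipsoid m = {x \<in> config_space m. mnorm m x = 1}"

definition tangent_ellipsoid ::
    "('n::finite \<Rightarrow> real) \<Rightarrow> real ^ 'd ^ 'n \<Rightarrow> (real ^ 'd ^ 'n) set" where
  "tangent_ellipsoid m s = {v. centred m v \<and> mass_mult m s \<bullet> v = 0}"

text \<open>Critical points of the restriction of the potential to the ellipsoid: the differential
  vanishes on the tangent space.\<close>

definition central_configurations ::
    "real \<Rightarrow> ('n::{finite,linorder} \<Rightarrow> real) \<Rightarrow> (real ^ 'd ^ 'n::{finite,linorder}) set" where
  "central_configurations \<alpha> m =
     {s \<in> ellipsoid m. \<exists>D. GDERIV (potential \<alpha> m) s :> D \<and> (\<forall>v\<in>tangent_ellipsoid m s. D \<bullet> v = 0)}"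

text \<open>The continuous representatives of \<open>W\<^sup>1\<^sup>,\<^sup>1\<close> and \<open>H\<^sup>1\<close> functions on \<open>[0, 1]\<close>; weak derivatives are
  unique up to null sets.\<close>

definition has_weak_derivative ::
    "(real \<Rightarrow> 'a::euclidean_space) \<Rightarrow> (real \<Rightarrow> 'a) \<Rightarrow> bool" where
  "has_weak_derivative x g \<longleftrightarrow>
     g absolutely_integrable_on {0..1} \<and> (\<forall>t\<in>{0..1}. x t = x 0 + integral {0..t} g)"

definition weak_derivative :: "(real \<Rightarrow> 'a::euclidean_space) \<Rightarrow> real \<Rightarrow> 'a" where
  "weak_derivative x = (SOME g. has_weak_derivative x g)"

definition H1 :: "(real \<Rightarrow> 'a::euclidean_space) set" where
  "H1 = {x. \<exists>g. has_weak_derivative x g \<and> (\<lambda>t. (norm (g t))\<^sup>2) integrable_on {0..1}}"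

definition action ::
    "real \<Rightarrow> ('n::{finite,linorder} \<Rightarrow> real) \<Rightarrow> (real \<Rightarrow> real ^ 'd ^ 'n::{finite,linorder}) \<Rightarrow> ennreal" where
  "action \<alpha> m x =
     (if \<exists>g. has_weak_derivative x g
      then ennreal (1 / 2) * (\<integral>\<^sup>+t\<in>{0..1}. ennreal ((mnorm m (weak_derivative x t))\<^sup>2) \<partial>lebesgue)
           + (\<integral>\<^sup>+t\<in>{0..1}. epotential \<alpha> m (x t) \<partial>lebesgue)
      else \<infinity>)"

text \<open>The normalisation involves the one-sided derivative at \<open>0\<close>.\<close>

definition total_collision_solution ::
    "real \<Rightarrow> ('n::{finite,linorder} \<Rightarrow> real) \<Rightarrow> (real \<Rightarrow> real ^ 'd ^ 'n::{finite,linorder}) \<Rightarrow> bool" where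
  "total_collision_solution \<alpha> m x \<longleftrightarrow>
     continuous_on {0..1} x \<and>
     (\<forall>t\<in>{0..1}. centred m (x t)) \<and>
     (\<forall>t\<in>{0..<1}. x t \<notin> collisions) \<and>
     x 1 = 0 \<and>
     (\<exists>x' x''. continuous_on {0<..<1} x'' \<and>
        (\<forall>t\<in>{0<..<1}. (x has_vector_derivative x' t) (at t) \<and>
                       (x' has_vector_derivative x'' t) (at t) \<and>
                       GDERIV (potential \<alpha> m) (x t) :> mass_mult m (x'' t))) \<and>
     action \<alpha> m x < \<infinity> \<and>
     mnorm m (x 0) = 1 \<and>
     (\<exists>v. (x has_vector_derivative v) (at 0 within {0..1}) \<and> mnorm m v = 1)"

definition shape :: "('n::finite \<Rightarrow> real) \<Rightarrow> real ^ 'd ^ 'n \<Rightarrow> real ^ 'd ^ 'n" where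
  "shape m x = x /\<^sub>R mnorm m x"

text \<open>The distance is \<open>\<infinity>\<close> (not \<open>0\<close>, as for \<^const>\<open>infdist\<close>) when \<open>K\<close> is empty.\<close>

definition asymptotic_to ::
    "('n::finite \<Rightarrow> real) \<Rightarrow> (real ^ 'd ^ 'n) set \<Rightarrow> (real \<Rightarrow> real ^ 'd ^ 'n) \<Rightarrow> bool" where
  "asymptotic_to m K x \<longleftrightarrow>
     ((\<lambda>t. INF k\<in>K. ereal (mnorm m (shape m (x t) - k))) \<longlongrightarrow> 0) (at_left 1)"

definition rho :: "real \<Rightarrow> ('n::finite \<Rightarrow> real) \<Rightarrow> real ^ 'd ^ 'n \<Rightarrow> real" where
  "rho \<alpha> m x = mnorm m x powr ((2 - \<alpha>) / 4)"

text \<open>The inverse of the coordinate map \<open>x \<mapsto> (\<rho>, s)\<close>: \<open>x = r s\<close> with \<open>r = \<rho>\<^bsup>4/(2-\<alpha>)\<^esup>\<close>.\<close>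

definition from_coords :: "real \<Rightarrow> real \<Rightarrow> real ^ 'd ^ 'n \<Rightarrow> real ^ 'd ^ 'n" where
  "from_coords \<alpha> \<rho> s = (\<rho> powr (4 / (2 - \<alpha>))) *\<^sub>R s"

text \<open>The variation \<open>\<phi>\<close> has components \<open>(\<zeta>, v)\<close> iff \<open>\<phi> t\<close> is the image of \<open>(\<zeta> t, v t)\<close> under the
  differential of \<^const>\<open>from_coords\<close> at the coordinates of \<open>x t\<close>, i.e. the velocity at
  \<open>\<epsilon> = 0\<close> of the curve below.\<close>

definition compact_variation ::
    "real \<Rightarrow> ('n::finite \<Rightarrow> real) \<Rightarrow> (real \<Rightarrow> real ^ 'd ^ 'n) \<Rightarrow> real \<Rightarrow> real \<Rightarrow>
     (real \<Rightarrow> real ^ 'd ^ 'n) \<Rightarrow> bool" where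
  "compact_variation \<alpha> m x a b \<phi> \<longleftrightarrow>
     \<phi> \<in> H1 \<and>
     closure {t \<in> {0..1}. \<phi> t \<noteq> 0} \<subseteq> {a<..<b} \<and>
     (\<exists>(\<zeta> :: real \<Rightarrow> real) v. \<forall>t\<in>{a<..<b}.
        v t \<in> tangent_ellipsoid m (shape m (x t)) \<and>
        ((\<lambda>\<epsilon>. from_coords \<alpha> (rho \<alpha> m (x t) + \<epsilon> * \<zeta> t) (shape m (x t) + \<epsilon> *\<^sub>R v t))
           has_vector_derivative \<phi> t) (at 0))"

definition asymptotically_minimal ::
    "real \<Rightarrow> ('n::{finite,linorder} \<Rightarrow> real) \<Rightarrow> (real ^ 'd ^ 'n::{finite,linorder}) set \<Rightarrow> bool" where
  "asymptotically_minimal \<alpha> m K \<longleftrightarrow>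
     K \<subseteq> central_configurations \<alpha> m \<and>
     (\<forall>x. total_collision_solution \<alpha> m x \<and> asymptotic_to m K x \<longrightarrow>
        (\<exists>\<tau>\<in>{0<..<1}. \<forall>\<phi>. compact_variation \<alpha> m x \<tau> 1 \<phi> \<and> (\<exists>t\<in>{0..1}. \<phi> t \<noteq> 0) \<longrightarrow>
           action \<alpha> m x < action \<alpha> m (\<lambda>t. x t + \<phi> t)))"

end

theory Submission
  imports Defs
begin

text \<open>
  Let \<open>x\<close> be the solution and \<open>\<phi>\<close> a variation supported in \<open>[a, b] \<subseteq> (\<tau>, 1)\<close>. Newton's equation
  \<open>M x'' = \<nabla>U(x)\<close> and an integration by parts remove the first-order terms, so that
  \<open>A(x + \<phi>) - A(x) = \<integral> \<bar>\<phi>'\<bar>\<^sup>2 / 2 + (U(x + \<phi>) - U(x) - \<nabla>U(x) \<bullet> \<phi>)\<close>.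
  Three estimates show that this is positive when \<open>\<alpha>\<close> is small, however large \<open>\<phi>\<close> is.

  The function \<open>u \<mapsto> u\<^bsup>-\<alpha>/2\<^esup>\<close> is convex, and \<open>\<bar>z + w\<bar>\<^sup>2\<close> is quadratic in \<open>w\<close>. The tangent inequality at
  \<open>u = \<bar>z\<bar>\<^sup>2\<close> therefore bounds the potential part below, for every \<open>\<phi>\<close>, by
  \<open>-(\<alpha>/2) \<Sum> m\<^sub>i m\<^sub>j \<bar>x\<^sub>i - x\<^sub>j\<bar>\<^bsup>-\<alpha>-2\<^esup> \<bar>\<phi>\<^sub>i - \<phi>\<^sub>j\<bar>\<^sup>2\<close> (\<open>potential_above_tangent\<close>). Close to the
  collision the shape of \<open>x\<close> stays at a fixed distance from the collisions, by asymptoticity and the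
  choice of \<open>\<delta>\<close>, so the sum is at most \<open>C r\<^bsup>-\<alpha>-2\<^esup> \<bar>\<phi>\<bar>\<^sup>2\<close> with \<open>r = \<bar>x\<bar>\<close> and \<open>C\<close> independent of \<open>\<alpha> \<le> 1\<close>
  (\<open>asymptotic_separation\<close>, \<open>pair_sum_bound\<close>).

  The collapse is not too fast: \<open>r\<^bsup>\<alpha>+2\<^esup> \<ge> B (1 - t)\<^sup>2\<close> near \<open>t = 1\<close>, again with \<open>B\<close> independent of
  \<open>\<alpha> \<le> 1\<close> (\<open>total_collision_lower_rate\<close>). Indeed, conservation of energy turns the Lagrange-Jacobi identity for
  \<open>I = r\<^sup>2\<close> into \<open>I'' \<ge> (2 - \<alpha>) B I\<^bsup>-\<alpha>/2\<^esup>\<close> near the collision, and multiplying by \<open>I' < 0\<close> makes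
  \<open>I'\<^sup>2 / 2 - 2 B I\<^bsup>1-\<alpha>/2\<^esup>\<close> nonincreasing with limit at least \<open>0\<close>, which integrates to the rate.

  Hence the potential part is at least \<open>-(\<alpha>/2)(C/B) \<integral> \<bar>\<phi>\<bar>\<^sup>2 / (1 - t)\<^sup>2\<close>, whereas Hardy's inequality
  (\<open>Hardy_inequality\<close>) bounds the kinetic part below by \<open>1/8 \<integral> \<bar>\<phi>\<bar>\<^sup>2 / (1 - t)\<^sup>2\<close>. For \<open>\<alpha> \<le> 1\<close>
  and \<open>\<alpha> < B / (8 C)\<close> the sum is at least \<open>1/16 \<integral> \<bar>\<phi>\<bar>\<^sup>2 / (1 - t)\<^sup>2 > 0\<close>.
\<close>

section \<open>Indefinite integrals of integrable functions\<close>

text \<open>An additive bound that holds on all short subintervals holds on the whole interval.\<close>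

lemma increment_le_of_small_steps:
  fixes E :: "real \<Rightarrow> real" and W :: "real \<Rightarrow> real"
  assumes "a \<le> b" "\<delta> > 0"
    and step: "\<And>s t. a \<le> s \<Longrightarrow> s \<le> t \<Longrightarrow> t \<le> b \<Longrightarrow> t - s < \<delta> \<Longrightarrow> \<bar>E t - E s\<bar> \<le> \<epsilon> * (W t - W s)"
  shows "\<bar>E b - E a\<bar> \<le> \<epsilon> * (W b - W a)"
proof -
  obtain n :: nat where n: "(b - a) / \<delta> < real n" using reals_Archimedean2 by blast
  moreover have "(b - a) / \<delta> \<ge> 0" using assms by simp
  ultimately have n0: "real n > 0" by linarith
  define h where "h = (b - a) / real n"
  have h: "0 \<le> h" "h < \<delta>" and hn: "real n * h = b - a"
    using n n0 assms(1,2) by (auto simp: h_def field_simps)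
  have "\<bar>E (a + real k * h) - E a\<bar> \<le> \<epsilon> * (W (a + real k * h) - W a)" if "k \<le> n" for k
    using that
  proof (induction k)
    case (Suc k)
    have "real (Suc k) * h \<le> real n * h"
      using Suc.prems h by (intro mult_right_mono) auto
    then have "\<bar>E (a + real (Suc k) * h) - E (a + real k * h)\<bar>
        \<le> \<epsilon> * (W (a + real (Suc k) * h) - W (a + real k * h))"
      using h hn by (intro step) (auto simp: algebra_simps)
    with Suc show ?case by (simp add: right_diff_distrib)
  qed simp
  from this[of n] show ?thesis using hn by simp
qed

lemma continuous_on_indefinite_integral:
  fixes u f :: "real \<Rightarrow> 'a::euclidean_space"
  assumes f: "f integrable_on {a..b}" and u: "\<And>t. t \<in> {a..b} \<Longrightarrow> u t = u a + integral {a..t} f"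
  shows "continuous_on {a..b} u"
proof -
  have "continuous_on {a..b} (\<lambda>t. u a + integral {a..t} f)"
    by (intro continuous_intros indefinite_integral_continuous_1 f)
  then show ?thesis by (rule continuous_on_eq) (rule u[symmetric])
qed

lemma absolutely_integrable_inner_continuous:
  fixes u g :: "real \<Rightarrow> 'a::euclidean_space"
  assumes "continuous_on {a..b} u" "g absolutely_integrable_on {a..b}"
  shows "(\<lambda>t. u t \<bullet> g t) absolutely_integrable_on {a..b}"
proof (rule absolutely_integrable_bounded_measurable_product[where h = "(\<bullet>)"])
  show "bilinear ((\<bullet>) :: 'a \<Rightarrow> 'a \<Rightarrow> real)"
    by (auto simp: bilinear_def inner_add_left inner_add_right intro!: linearI)
  show "u \<in> borel_measurable (lebesgue_on {a..b})"
    using assms(1) by (simp add: continuous_imp_measurable_on_sets_lebesgue)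
  show "bounded (u ` {a..b})"
    using assms(1) by (simp add: compact_continuous_image compact_imp_bounded)
qed (use assms in auto)

lemma integral_difference:
  fixes f :: "real \<Rightarrow> 'a::euclidean_space"
  assumes "f integrable_on {a..b}" "a \<le> s" "s \<le> t" "t \<le> b"
  shows "integral {a..t} f - integral {a..s} f = integral {s..t} f"
proof -
  have "f integrable_on {a..t}" using assms by (auto intro: integrable_on_subinterval)
  from Henstock_Kurzweil_Integration.integral_combine[OF assms(2,3) this] show ?thesis by (simp add: algebra_simps)
qed

text \<open>Integration by parts for two absolutely continuous functions. No differentiability almost everywhere is
  needed: with \<open>E t = u t \<bullet> v t - \<integral>\<^sub>a\<^sup>t (u \<bullet> g + v \<bullet> f)\<close>, uniform continuity of \<open>u\<close> and \<open>v\<close> gives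
  \<open>\<bar>E t - E s\<bar> \<le> \<epsilon> \<integral>\<^sub>s\<^sup>t (\<bar>f\<bar> + \<bar>g\<bar>)\<close> for short \<open>[s, t]\<close>, so \<open>E\<close> is constant.\<close>

lemma integration_by_parts_AC:
  fixes u v f g :: "real \<Rightarrow> 'a::euclidean_space"
  assumes ab: "a \<le> b"
    and f: "f absolutely_integrable_on {a..b}" and g: "g absolutely_integrable_on {a..b}"
    and u: "\<And>t. t \<in> {a..b} \<Longrightarrow> u t = u a + integral {a..t} f"
    and v: "\<And>t. t \<in> {a..b} \<Longrightarrow> v t = v a + integral {a..t} g"
  shows "(\<lambda>t. u t \<bullet> g t + v t \<bullet> f t) absolutely_integrable_on {a..b}"
    and "integral {a..b} (\<lambda>t. u t \<bullet> g t + v t \<bullet> f t) = u b \<bullet> v b - u a \<bullet> v a"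
proof -
  have fi: "f integrable_on {a..b}" and gi: "g integrable_on {a..b}"
    using f g by (auto simp: set_lebesgue_integral_eq_integral)
  have uc: "continuous_on {a..b} u" and vc: "continuous_on {a..b} v"
    using continuous_on_indefinite_integral[OF fi u] continuous_on_indefinite_integral[OF gi v] by auto
  have ugi: "(\<lambda>t. u t \<bullet> g t) absolutely_integrable_on {a..b}"
    and vfi: "(\<lambda>t. v t \<bullet> f t) absolutely_integrable_on {a..b}"
    using absolutely_integrable_inner_continuous uc vc f g by auto
  let ?h = "\<lambda>t. u t \<bullet> g t + v t \<bullet> f t"
  show hi: "?h absolutely_integrable_on {a..b}" using ugi vfi by (rule set_integral_add)
  then have hint: "?h integrable_on {a..b}" by (auto simp: set_lebesgue_integral_eq_integral)
  have nf: "(\<lambda>t. norm (f t)) integrable_on {a..b}" and ng: "(\<lambda>t. norm (g t)) integrable_on {a..b}"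
    using f g absolutely_integrable_on_def by blast+
  define w where "w t = norm (f t) + norm (g t)" for t
  have wi: "w integrable_on {a..b}" unfolding w_def using nf ng by (rule integrable_add)
  define W where "W t = integral {a..t} w" for t
  define E where "E t = u t \<bullet> v t - integral {a..t} ?h" for t
  have small: "\<bar>E b - E a\<bar> \<le> \<epsilon> * (W b - W a)" if "\<epsilon> > 0" for \<epsilon>
  proof -
    have "uniformly_continuous_on {a..b} u" "uniformly_continuous_on {a..b} v"
      using uc vc by (auto intro: compact_uniformly_continuous)
    then obtain d1 d2 where d: "d1 > 0" "d2 > 0"
      and d1: "\<And>s t. s \<in> {a..b} \<Longrightarrow> t \<in> {a..b} \<Longrightarrow> dist s t < d1 \<Longrightarrow> dist (u s) (u t) < \<epsilon>"
      and d2: "\<And>s t. s \<in> {a..b} \<Longrightarrow> t \<in> {a..b} \<Longrightarrow> dist s t < d2 \<Longrightarrow> dist (v s) (v t) < \<epsilon>"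
      using \<open>\<epsilon> > 0\<close> unfolding uniformly_continuous_on_def by metis
    show ?thesis
    proof (rule increment_le_of_small_steps[OF ab, where \<delta> = "min d1 d2"])
      show "0 < min d1 d2" using d by simp
      fix s t assume st: "a \<le> s" "s \<le> t" "t \<le> b" "t - s < min d1 d2"
      have sub: "{s..t} \<subseteq> {a..b}" using st by auto
      have fst: "f integrable_on {s..t}" "g integrable_on {s..t}" "?h integrable_on {s..t}" "w integrable_on {s..t}"
        using fi gi hint wi sub by (auto intro: integrable_on_subinterval)
      have du: "u t - u s = integral {s..t} f" and dv: "v t - v s = integral {s..t} g"
        using u[of t] u[of s] v[of t] v[of s] st integral_difference[OF fi, of s t]
          integral_difference[OF gi, of s t] by (auto simp: algebra_simps)
      have I1: "((\<lambda>w. u t \<bullet> g w) has_integral u t \<bullet> (v t - v s)) {s..t}"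
        using has_integral_linear[OF integrable_integral[OF fst(2)] bounded_linear_inner_right[of "u t"]] dv
        by (simp add: o_def)
      have I2: "((\<lambda>w. v s \<bullet> f w) has_integral v s \<bullet> (u t - u s)) {s..t}"
        using has_integral_linear[OF integrable_integral[OF fst(1)] bounded_linear_inner_right[of "v s"]] du
        by (simp add: o_def)
      have I3: "((\<lambda>r. (u t \<bullet> g r + v s \<bullet> f r) - ?h r) has_integral
           (u t \<bullet> (v t - v s) + v s \<bullet> (u t - u s)) - integral {s..t} ?h) {s..t}"
        by (intro has_integral_diff has_integral_add I1 I2 integrable_integral fst)
      have "E t - E s = (u t \<bullet> (v t - v s) + v s \<bullet> (u t - u s)) - integral {s..t} ?h"
        using integral_difference[OF hint, of s t] st
        by (simp add: E_def inner_diff_right inner_commute algebra_simps)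
      also have "\<dots> = integral {s..t} (\<lambda>r. (u t \<bullet> g r + v s \<bullet> f r) - ?h r)"
        using I3 by (simp add: integral_unique)
      also have "norm \<dots> \<le> integral {s..t} (\<lambda>r. \<epsilon> * w r)"
      proof (rule integral_norm_bound_integral)
        show "(\<lambda>r. (u t \<bullet> g r + v s \<bullet> f r) - ?h r) integrable_on {s..t}" using I3 by blast
        show "(\<lambda>r. \<epsilon> * w r) integrable_on {s..t}" using fst(4) by (rule integrable_on_mult_right)
        fix r assume r: "r \<in> {s..t}"
        have "dist (u t) (u r) < \<epsilon>" "dist (v s) (v r) < \<epsilon>"
          using r st by (auto intro!: d1 d2 simp: dist_real_def)
        then have b: "norm (u t - u r) \<le> \<epsilon>" "norm (v s - v r) \<le> \<epsilon>" by (auto simp: dist_norm)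
        have "(u t \<bullet> g r + v s \<bullet> f r) - ?h r = (u t - u r) \<bullet> g r + (v s - v r) \<bullet> f r"
          by (simp add: inner_diff_left)
        also have "norm \<dots> \<le> \<bar>(u t - u r) \<bullet> g r\<bar> + \<bar>(v s - v r) \<bullet> f r\<bar>" by simp
        also have "\<dots> \<le> norm (u t - u r) * norm (g r) + norm (v s - v r) * norm (f r)"
          by (intro add_mono Cauchy_Schwarz_ineq2)
        also have "\<dots> \<le> \<epsilon> * norm (g r) + \<epsilon> * norm (f r)"
          using b by (intro add_mono mult_right_mono) auto
        finally show "norm ((u t \<bullet> g r + v s \<bullet> f r) - ?h r) \<le> \<epsilon> * w r" by (simp add: w_def algebra_simps)
      qed
      also have "\<dots> = \<epsilon> * (W t - W s)"
        using integral_difference[OF wi, of s t] st by (simp add: W_def)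
      finally show "\<bar>E t - E s\<bar> \<le> \<epsilon> * (W t - W s)" by simp
    qed
  qed
  have W0: "W b - W a \<ge> 0"
    using wi by (auto simp: W_def w_def intro!: integral_nonneg)
  have "\<bar>E b - E a\<bar> \<le> 0 + e" if "e > 0" for e
  proof -
    have "\<bar>E b - E a\<bar> \<le> (e / (W b - W a + 1)) * (W b - W a)"
      using W0 that by (intro small) auto
    also have "\<dots> \<le> e" using W0 that by (simp add: field_simps)
    finally show ?thesis by simp
  qed
  then have "\<bar>E b - E a\<bar> \<le> 0" by (rule field_le_epsilon)
  then show "integral {a..b} ?h = u b \<bullet> v b - u a \<bullet> v a"
    by (simp add: E_def)
qed

text \<open>A consequence of the Lebesgue differentiation theorem.\<close>

lemma indefinite_integral_zero_imp_negligible: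
  fixes f :: "real \<Rightarrow> 'a::euclidean_space"
  assumes f: "f integrable_on {a..b}" and z: "\<And>t. t \<in> {a..b} \<Longrightarrow> integral {a..t} f = 0"
  shows "negligible {t \<in> {a..b}. f t \<noteq> 0}"
proof -
  let ?F = "\<lambda>t. if t \<in> {a..b} then f t else 0"
  have int: "?F integrable_on cbox c d" for c d
  proof -
    have "?F integrable_on UNIV" using f by (subst integrable_restrict_UNIV)
    then show ?thesis by (rule integrable_on_subcbox) simp
  qed
  obtain N where N: "negligible N"
    and lim: "\<And>x e. \<lbrakk>x \<notin> N; 0 < e\<rbrakk> \<Longrightarrow> \<exists>d>0. \<forall>h. 0 < h \<and> h < d \<longrightarrow>
              norm(integral (cbox x (x + h *\<^sub>R One)) ?F /\<^sub>R h ^ DIM(real) - ?F x) < e"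
    by (rule integrable_ccontinuous_explicit[OF int]) (rule that; assumption)
  have "f x = 0" if x: "x \<in> {a..b}" "x \<notin> N" "x \<noteq> b" for x
  proof (rule ccontr)
    assume "f x \<noteq> 0"
    then obtain d where d: "d > 0" "\<And>h. 0 < h \<Longrightarrow> h < d \<Longrightarrow>
        norm(integral (cbox x (x + h *\<^sub>R One)) ?F /\<^sub>R h ^ DIM(real) - ?F x) < norm (f x)"
      using lim[OF x(2), of "norm (f x)"] by auto
    define h where "h = min (d / 2) (b - x)"
    have h: "0 < h" "h < d" "x + h \<le> b" using d x by (auto simp: h_def)
    have "integral {x..x+h} ?F = integral {x..x+h} f"
      using x h by (intro integral_cong) auto
    also have "\<dots> = integral {a..x+h} f - integral {a..x} f"
      using integral_difference[OF f, of x "x+h"] x h by simp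
    also have "\<dots> = 0" using z x h by simp
    finally show False using d(2)[OF h(1,2)] x by simp
  qed
  then have "{t \<in> {a..b}. f t \<noteq> 0} \<subseteq> insert b N" by auto
  moreover have "negligible (insert b N)" using N by (simp add: negligible_insert)
  ultimately show ?thesis by (rule negligible_subset[rotated])
qed

section \<open>Weak derivatives\<close>

lemma has_weak_derivative_absolutely_integrable:
  "has_weak_derivative x g \<Longrightarrow> g absolutely_integrable_on {0..1}"
  unfolding has_weak_derivative_def by (rule conjunct1)

lemma has_weak_derivative_integrable: "has_weak_derivative x g \<Longrightarrow> g integrable_on {0..1}"
  by (intro set_lebesgue_integral_eq_integral(1) has_weak_derivative_absolutely_integrable)

lemma has_weak_derivative_continuous:
  assumes "has_weak_derivative x g"
  shows "continuous_on {0..1} x"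
proof (rule continuous_on_indefinite_integral)
  show "g integrable_on {0..1}" using assms by (rule has_weak_derivative_integrable)
  show "x t = x 0 + integral {0..t} g" if "t \<in> {0..1}" for t
    using assms that unfolding has_weak_derivative_def by blast
qed

lemma has_weak_derivative_increment:
  assumes g: "has_weak_derivative x g" and ab: "0 \<le> a" "a \<le> t" "t \<le> 1"
  shows "x t = x a + integral {a..t} g"
proof -
  have gi: "g integrable_on {0..1}" using g by (rule has_weak_derivative_integrable)
  have inc: "x s = x 0 + integral {0..s} g" if "s \<in> {0..1}" for s
    using g that unfolding has_weak_derivative_def by blast
  have "x t = x 0 + integral {0..t} g" "x a = x 0 + integral {0..a} g"
    using ab by (intro inc; simp)+
  then show ?thesis using integral_difference[OF gi, of a t] ab by (simp add: algebra_simps)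
qed

lemma has_weak_derivative_spike:
  assumes g: "has_weak_derivative x g" and neg: "negligible {t \<in> {0..1}. g t \<noteq> h t}"
  shows "has_weak_derivative x h"
  unfolding has_weak_derivative_def
proof
  have "g absolutely_integrable_on {0..1}" using g by (rule has_weak_derivative_absolutely_integrable)
  then show "h absolutely_integrable_on {0..1}"
    by (rule absolutely_integrable_spike[OF _ neg]) auto
  show "\<forall>t\<in>{0..1}. x t = x 0 + integral {0..t} h"
  proof
    fix t :: real assume t: "t \<in> {0..1}"
    have "integral {0..t} h = integral {0..t} g"
      by (rule integral_spike[OF neg]) (use t in auto)
    then show "x t = x 0 + integral {0..t} h"
      using has_weak_derivative_increment[OF g, of 0 t] t by simp
  qed
qed

lemma has_weak_derivative_unique:
  assumes g: "has_weak_derivative x g" and h: "has_weak_derivative x h"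
  shows "negligible {t \<in> {0..1}. g t \<noteq> h t}"
proof -
  have gi: "g integrable_on {0..1}" and hi: "h integrable_on {0..1}"
    using has_weak_derivative_integrable[OF g] has_weak_derivative_integrable[OF h] .
  have "negligible {t \<in> {0..1}. g t - h t \<noteq> 0}"
  proof (rule indefinite_integral_zero_imp_negligible)
    show "(\<lambda>t. g t - h t) integrable_on {0..1}" using gi hi by (rule integrable_diff)
    fix t :: real assume t: "t \<in> {0..1}"
    have "g integrable_on {0..t}" "h integrable_on {0..t}"
      using gi hi t by (auto intro: integrable_on_subinterval)
    then have "integral {0..t} (\<lambda>t. g t - h t) = integral {0..t} g - integral {0..t} h"
      by (rule Henstock_Kurzweil_Integration.integral_diff)
    then show "integral {0..t} (\<lambda>t. g t - h t) = 0"
      using has_weak_derivative_increment[OF g, of 0 t] has_weak_derivative_increment[OF h, of 0 t] t by simp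
  qed
  then show ?thesis by simp
qed

lemma has_weak_derivative_add:
  assumes g: "has_weak_derivative x g" and h: "has_weak_derivative y h"
  shows "has_weak_derivative (\<lambda>t. x t + y t) (\<lambda>t. g t + h t)"
  unfolding has_weak_derivative_def
proof
  have gi: "g integrable_on {0..1}" and hi: "h integrable_on {0..1}"
    using has_weak_derivative_integrable[OF g] has_weak_derivative_integrable[OF h] .
  show "(\<lambda>t. g t + h t) absolutely_integrable_on {0..1}"
    using has_weak_derivative_absolutely_integrable[OF g] has_weak_derivative_absolutely_integrable[OF h]
    by (rule set_integral_add)
  show "\<forall>t\<in>{0..1}. x t + y t = x 0 + y 0 + integral {0..t} (\<lambda>t. g t + h t)"
  proof
    fix t :: real assume t: "t \<in> {0..1}"
    have "g integrable_on {0..t}" "h integrable_on {0..t}"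
      using gi hi t by (auto intro: integrable_on_subinterval)
    then have "integral {0..t} (\<lambda>t. g t + h t) = integral {0..t} g + integral {0..t} h"
      by (rule Henstock_Kurzweil_Integration.integral_add)
    then show "x t + y t = x 0 + y 0 + integral {0..t} (\<lambda>t. g t + h t)"
      using has_weak_derivative_increment[OF g, of 0 t] has_weak_derivative_increment[OF h, of 0 t] t by simp
  qed
qed

section \<open>The mass inner product\<close>

lemma mass_inner_eq_sum: "mass_mult m u \<bullet> v = (\<Sum>i\<in>UNIV. m i * (u $ i \<bullet> v $ i))"
  unfolding mass_mult_def by (subst inner_vec_def) simp

lemma mass_inner_commute: "mass_mult m u \<bullet> v = mass_mult m v \<bullet> u"
  unfolding mass_inner_eq_sum by (simp add: inner_commute)

lemma linear_mass_mult: "linear (mass_mult m)"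
  by (auto simp: mass_mult_def vec_eq_iff scaleR_add_right intro!: linearI)

lemma bounded_linear_mass_mult:
  "bounded_linear (mass_mult m :: real ^ 'd ^ 'n::finite \<Rightarrow> _)"
  using linear_mass_mult by (simp add: linear_conv_bounded_linear)

lemma mass_mult_sqrt:
  assumes "\<And>i. m i > (0::real)"
  shows "mass_mult (\<lambda>i. sqrt (m i)) u \<bullet> mass_mult (\<lambda>i. sqrt (m i)) v = mass_mult m u \<bullet> v"
  using assms[THEN less_imp_le]
  by (subst inner_vec_def, subst mass_inner_eq_sum) (simp add: mass_mult_def mult.assoc[symmetric])

lemma mnorm_eq_norm:
  assumes "\<And>i. m i > (0::real)"
  shows "mnorm m y = norm (mass_mult (\<lambda>i. sqrt (m i)) y)"
  by (simp add: mnorm_def norm_eq_sqrt_inner mass_mult_sqrt[OF assms])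

lemma mass_inner_continuous:
  fixes u v :: "real \<Rightarrow> real ^ 'd ^ 'n::finite"
  shows "continuous_on S u \<Longrightarrow> continuous_on S v \<Longrightarrow> continuous_on S (\<lambda>t. mass_mult m (u t) \<bullet> v t)"
  by (intro continuous_intros bounded_linear.continuous_on[OF bounded_linear_mass_mult])

context
  fixes m :: "'n::finite \<Rightarrow> real"
  assumes m: "\<And>i. m i > 0"
begin

lemma mass_inner_self_nonneg: "mass_mult m y \<bullet> y \<ge> 0"
  unfolding mass_inner_eq_sum using m[THEN less_imp_le] by (intro sum_nonneg mult_nonneg_nonneg) auto

lemma mnorm_power2: "(mnorm m y)\<^sup>2 = mass_mult m y \<bullet> y"
  by (simp add: mnorm_def mass_inner_self_nonneg)

lemma mnorm_nonneg: "mnorm m y \<ge> 0"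
  by (simp add: mnorm_eq_norm[OF m])

lemma mnorm_eq_0: "mnorm m y = 0 \<longleftrightarrow> y = 0"
proof -
  have "sqrt (m i) \<noteq> 0" for i using m[of i] by simp
  then show ?thesis by (auto simp: mnorm_eq_norm[OF m] mass_mult_def vec_eq_iff)
qed

lemma mnorm_pos: "y \<noteq> 0 \<Longrightarrow> mnorm m y > 0"
  using mnorm_nonneg[of y] mnorm_eq_0[of y] by simp

lemma mnorm_triangle: "mnorm m (y + z) \<le> mnorm m y + mnorm m z"
  unfolding mnorm_eq_norm[OF m] linear_add[OF linear_mass_mult] by (rule norm_triangle_ineq)

lemma mnorm_minus_commute: "mnorm m (y - z) = mnorm m (z - y)"
  unfolding mnorm_eq_norm[OF m] linear_diff[OF linear_mass_mult] by (rule norm_minus_commute)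

lemma body_le_mnorm: "m i * (norm (y $ i))\<^sup>2 \<le> (mnorm m y)\<^sup>2"
proof -
  have "m i * (norm (y $ i))\<^sup>2 = (\<Sum>j\<in>{i}. m j * (y $ j \<bullet> y $ j))" by (simp add: power2_norm_eq_inner)
  also have "\<dots> \<le> (\<Sum>j\<in>UNIV. m j * (y $ j \<bullet> y $ j))"
    using m[THEN less_imp_le] by (intro sum_mono2) (auto intro!: mult_nonneg_nonneg)
  finally show ?thesis by (simp add: mnorm_power2 mass_inner_eq_sum)
qed

end

section \<open>Hardy's inequality\<close>

text \<open>The constant 4 comes from integrating \<open>0 \<le> \<bar>g + \<phi> / (2 (1 - t))\<bar>\<^sup>2\<close> over \<open>[a, b]\<close>, where the cross term
  is a derivative up to \<open>-\<bar>\<phi>\<bar>\<^sup>2 / (2 (1 - t)\<^sup>2)\<close>.\<close>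

lemma Hardy_inequality:
  fixes m :: "'n::finite \<Rightarrow> real" and \<phi> g :: "real \<Rightarrow> real ^ 'd ^ 'n::finite"
  assumes m: "\<And>i. m i > 0" and ab: "a \<le> b" "b < 1"
    and g: "g absolutely_integrable_on {a..b}"
    and g2: "(\<lambda>t. (mnorm m (g t))\<^sup>2) integrable_on {a..b}"
    and \<phi>: "\<And>t. t \<in> {a..b} \<Longrightarrow> \<phi> t = \<phi> a + integral {a..t} g"
    and \<phi>0: "\<phi> a = 0" "\<phi> b = 0"
  shows "(\<lambda>t. (mnorm m (\<phi> t))\<^sup>2 / (1 - t)\<^sup>2) integrable_on {a..b}"
    and "integral {a..b} (\<lambda>t. (mnorm m (\<phi> t))\<^sup>2 / (1 - t)\<^sup>2) \<le> 4 * integral {a..b} (\<lambda>t. (mnorm m (g t))\<^sup>2)"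
proof -
  have gi: "g integrable_on {a..b}"
    using g by (auto simp: set_lebesgue_integral_eq_integral)
  have \<phi>c: "continuous_on {a..b} \<phi>"
    by (rule continuous_on_indefinite_integral[OF gi \<phi>])
  let ?M = "mass_mult m" and ?N = "\<lambda>t. mass_mult m (\<phi> t) \<bullet> \<phi> t"
  let ?n = "\<lambda>t. ?M (\<phi> t) \<bullet> g t + \<phi> t \<bullet> ?M (g t)"
  let ?p = "\<lambda>t::real. 1 / (1 - t)" and ?q = "\<lambda>t::real. 1 / (1 - t)\<^sup>2"
  have Mg: "(\<lambda>t. ?M (g t)) absolutely_integrable_on {a..b}"
    using absolutely_integrable_linear[OF g bounded_linear_mass_mult] by (simp add: o_def)
  have M\<phi>: "?M (\<phi> t) = ?M (\<phi> a) + integral {a..t} (\<lambda>t. ?M (g t))" if "t \<in> {a..b}" for t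
  proof -
    have "g integrable_on {a..t}" using gi that by (auto intro: integrable_on_subinterval)
    then have "integral {a..t} (\<lambda>t. ?M (g t)) = ?M (integral {a..t} g)"
      using integral_linear[OF _ bounded_linear_mass_mult] by (auto simp: o_def)
    then show ?thesis using \<phi>[OF that] linear_add[OF linear_mass_mult] by metis
  qed
  have n: "?n absolutely_integrable_on {a..b}"
    by (rule integration_by_parts_AC(1)[OF ab(1) Mg g M\<phi> \<phi>])
  have N: "?N t = ?N a + integral {a..t} ?n" if t: "t \<in> {a..b}" for t
  proof -
    have sub: "{a..t} \<subseteq> {a..b}" using t by auto
    have "integral {a..t} ?n = ?N t - ?N a"
    proof (rule integration_by_parts_AC(2))
      show "(\<lambda>t. ?M (g t)) absolutely_integrable_on {a..t}" "g absolutely_integrable_on {a..t}"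
        using Mg g sub absolutely_integrable_on_subinterval by blast+
      show "a \<le> t" using t by simp
      show "?M (\<phi> r) = ?M (\<phi> a) + integral {a..r} (\<lambda>t. ?M (g t))" if "r \<in> {a..t}" for r
        by (rule M\<phi>) (use that t in simp)
      show "\<phi> r = \<phi> a + integral {a..r} g" if "r \<in> {a..t}" for r
        by (rule \<phi>) (use that t in simp)
    qed
    then show ?thesis by simp
  qed
  have qc: "continuous_on {a..b} ?q" using ab by (intro continuous_intros) auto
  have q: "?q absolutely_integrable_on {a..b}"
    using qc by (simp add: absolutely_integrable_continuous_real)
  have p: "?p t = ?p a + integral {a..t} ?q" if t: "t \<in> {a..b}" for t
  proof -
    have "(?q has_integral ?p t - ?p a) {a..t}"
      using t ab
      by (intro fundamental_theorem_of_calculus)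
        (auto intro!: derivative_eq_intros simp: has_real_derivative_iff_has_vector_derivative[symmetric] power2_eq_square)
    then show ?thesis by (simp add: integral_unique)
  qed
  let ?h = "\<lambda>t. ?p t * ?n t + ?N t * ?q t"
  have h: "?h absolutely_integrable_on {a..b}" and h0: "integral {a..b} ?h = 0"
    using integration_by_parts_AC[OF ab(1) q n p N] \<phi>0
    by (simp_all add: linear_0[OF linear_mass_mult])
  have Nq: "(\<lambda>t. ?N t * ?q t) integrable_on {a..b}"
    by (intro integrable_continuous_real continuous_intros mass_inner_continuous \<phi>c qc)
  have eqN: "(mnorm m (\<phi> t))\<^sup>2 / (1 - t)\<^sup>2 = ?N t * ?q t" for t
    by (simp add: mnorm_power2[where m = m, OF m])
  show "(\<lambda>t. (mnorm m (\<phi> t))\<^sup>2 / (1 - t)\<^sup>2) integrable_on {a..b}"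
    unfolding eqN by (rule Nq)
  have "((\<lambda>t. (mnorm m (g t))\<^sup>2 + (1/2) * ?h t - (1/4) * (?N t * ?q t)) has_integral
      integral {a..b} (\<lambda>t. (mnorm m (g t))\<^sup>2) + (1/2) * 0 - (1/4) * integral {a..b} (\<lambda>t. ?N t * ?q t)) {a..b}"
    using h h0
    by (intro has_integral_diff has_integral_add has_integral_mult_right integrable_integral g2 Nq)
      (auto simp: has_integral_integrable_integral set_lebesgue_integral_eq_integral)
  moreover have "0 \<le> (mnorm m (g t))\<^sup>2 + (1/2) * ?h t - (1/4) * (?N t * ?q t)" if t: "t \<in> {a..b}" for t
  proof -
    have "\<exists>c. p = 2 * c" for p :: real by (rule exI[of _ "p / 2"]) simp
    then obtain c where p2c: "?p t = 2 * c" by blast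
    have "?q t = (?p t)\<^sup>2" by (simp add: power_divide)
    then have c: "?p t = 2 * c" "?q t = 4 * c\<^sup>2" unfolding p2c by simp_all
    have "0 \<le> (mnorm m (g t + c *\<^sub>R \<phi> t))\<^sup>2" by simp
    also have "\<dots> = ?M (g t) \<bullet> g t + 2 * c * (?M (\<phi> t) \<bullet> g t) + c\<^sup>2 * ?N t"
      unfolding mnorm_power2[where m = m, OF m]
      using mass_inner_commute[of m "g t" "\<phi> t"]
      by (simp add: linear_add[OF linear_mass_mult] linear_cmul[OF linear_mass_mult]
          inner_add_left inner_add_right power2_eq_square algebra_simps)
    also have "\<dots> = (mnorm m (g t))\<^sup>2 + (1/2) * ?h t - (1/4) * (?N t * ?q t)"
      unfolding c mnorm_power2[where m = m, OF m]
      using mass_inner_commute[of m "g t" "\<phi> t"]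
      by (simp add: inner_commute[of "\<phi> t"] algebra_simps)
    finally show ?thesis .
  qed
  ultimately have "0 \<le> integral {a..b} (\<lambda>t. (mnorm m (g t))\<^sup>2) + (1/2) * 0
      - (1/4) * integral {a..b} (\<lambda>t. ?N t * ?q t)"
    by (rule has_integral_nonneg)
  then show "integral {a..b} (\<lambda>t. (mnorm m (\<phi> t))\<^sup>2 / (1 - t)\<^sup>2) \<le> 4 * integral {a..b} (\<lambda>t. (mnorm m (g t))\<^sup>2)"
    unfolding eqN by linarith
qed

section \<open>The potential\<close>

lemma powr_above_tangent:
  fixes u u0 p :: real
  assumes "u0 > 0" "u > 0" "p > 0"
  shows "u powr (- p) \<ge> u0 powr (- p) - p * u0 powr (- p - 1) * (u - u0)"
proof -
  define y where "y = u / u0"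
  have y: "y > 0" "u = u0 * y" using assms by (auto simp: y_def)
  have "1 - p * (y - 1) \<le> 1 + - p * ln y"
    using assms(3) ln_le_minus_one[OF y(1)] by simp
  also have "\<dots> \<le> exp (- p * ln y)" by (rule exp_ge_add_one_self)
  also have "\<dots> = y powr (- p)" using y by (simp add: powr_def)
  finally have "u0 powr (- p) * (1 - p * (y - 1)) \<le> u0 powr (- p) * y powr (- p)"
    by (rule mult_left_mono) simp
  also have "\<dots> = u powr (- p)" using y assms by (simp add: powr_mult)
  also have "u0 powr (- p) * (1 - p * (y - 1)) = u0 powr (- p) - p * u0 powr (- p - 1) * (u - u0)"
    using assms y(2) by (simp add: powr_diff field_simps)
  finally show ?thesis .
qed

text \<open>The tangent inequality at \<open>\<bar>z\<bar>\<^sup>2\<close>, evaluated at \<open>\<bar>z + w\<bar>\<^sup>2\<close>. It holds for all \<open>w \<noteq> -z\<close>, not only for small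
  \<open>w\<close>; this is what makes the minimality global.\<close>

lemma norm_powr_above_tangent:
  fixes z w :: "'a::real_inner"
  assumes "z \<noteq> 0" "z + w \<noteq> 0" "\<alpha> > 0"
  shows "norm (z + w) powr (- \<alpha>) \<ge> norm z powr (- \<alpha>) - \<alpha> * norm z powr (- \<alpha> - 2) * (z \<bullet> w)
     - \<alpha> / 2 * norm z powr (- \<alpha> - 2) * (norm w)\<^sup>2"
proof -
  have sq: "(norm y)\<^sup>2 powr q = norm y powr (2 * q)" if "y \<noteq> 0" for y :: 'a and q
    using that by (simp add: powr_powr flip: powr_numeral)
  have e: "(norm z)\<^sup>2 powr (- (\<alpha> / 2)) = norm z powr (- \<alpha>)"
    "(norm z)\<^sup>2 powr (- (\<alpha> / 2) - 1) = norm z powr (- \<alpha> - 2)"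
    "(norm (z + w))\<^sup>2 powr (- (\<alpha> / 2)) = norm (z + w) powr (- \<alpha>)"
    using sq[OF assms(1), of "- (\<alpha> / 2)"] sq[OF assms(1), of "- (\<alpha> / 2) - 1"]
      sq[OF assms(2), of "- (\<alpha> / 2)"] by simp_all
  have d: "(norm (z + w))\<^sup>2 - (norm z)\<^sup>2 = 2 * (z \<bullet> w) + (norm w)\<^sup>2"
    by (simp add: power2_norm_eq_inner inner_add_left inner_add_right inner_commute)
  have "(norm z)\<^sup>2 powr (- (\<alpha> / 2)) - \<alpha> / 2 * (norm z)\<^sup>2 powr (- (\<alpha> / 2) - 1) * ((norm (z + w))\<^sup>2 - (norm z)\<^sup>2)
     \<le> (norm (z + w))\<^sup>2 powr (- (\<alpha> / 2))"
    using assms by (intro powr_above_tangent) auto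
  then show ?thesis unfolding e d by (simp add: field_simps)
qed

text \<open>The differential of the potential at \<open>x\<close>, applied to \<open>h\<close>; it is one only if \<open>x\<close> is not a collision.\<close>

definition potential_differential ::
    "real \<Rightarrow> ('n::{finite,linorder} \<Rightarrow> real) \<Rightarrow> real ^ 'd ^ 'n::{finite,linorder} \<Rightarrow> real ^ 'd ^ 'n::{finite,linorder} \<Rightarrow> real" where
  "potential_differential \<alpha> m x h =
     (\<Sum>(i, j)\<in>{(i, j). i < j}. m i * m j *
        (- \<alpha> * norm (x $ i - x $ j) powr (- \<alpha> - 2) * ((x $ i - x $ j) \<bullet> (h $ i - h $ j))))"

lemma not_collision_iff: "x \<notin> collisions \<longleftrightarrow> (\<forall>i j. i \<noteq> j \<longrightarrow> x $ i \<noteq> x $ j)"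
  by (auto simp: collisions_def)

lemma exists_two_bodies:
  assumes "CARD('n::{finite,linorder}) \<ge> 2"
  obtains i j :: "'n::{finite,linorder}" where "i < j"
proof -
  obtain k l :: 'n where "k \<noteq> l"
    using assms by (metis card_2_iff' card_le_Suc0_iff_eq finite UNIV_I not_less_eq_eq numeral_2_eq_2)
  then show ?thesis using that by (cases k l rule: linorder_cases) auto
qed

lemma zero_in_collisions:
  assumes "CARD('n::{finite,linorder}) \<ge> 2"
  shows "(0 :: real ^ 'd ^ 'n::{finite,linorder}) \<in> collisions"
proof -
  obtain i j :: 'n where "i < j" using exists_two_bodies[OF assms] .
  then have "i \<noteq> j" by simp
  then show ?thesis unfolding collisions_def by force
qed

lemma potential_has_derivative:
  assumes x: "x \<notin> collisions"
  shows "(potential \<alpha> m has_derivative potential_differential \<alpha> m x) (at x)"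
proof -
  have pair: "((\<lambda>y. m i * m j * norm (y $ i - y $ j) powr (- \<alpha>)) has_derivative
      (\<lambda>h. m i * m j * (- \<alpha> * norm (x $ i - x $ j) powr (- \<alpha> - 2) * ((x $ i - x $ j) \<bullet> (h $ i - h $ j))))) (at x)"
    if "i < j" for i j
  proof -
    have ne: "x $ i - x $ j \<noteq> 0" using x that by (metis not_collision_iff less_irrefl right_minus_eq)
    have d: "((\<lambda>y. y $ i - y $ j) has_derivative (\<lambda>h. h $ i - h $ j)) (at x)"
      by (intro has_derivative_diff bounded_linear.has_derivative[OF bounded_linear_vec_nth] has_derivative_ident)
    have n: "((\<lambda>y. norm (y $ i - y $ j)) has_derivative
        (\<lambda>h. (h $ i - h $ j) \<bullet> sgn (x $ i - x $ j))) (at x)"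
      using has_derivative_compose[OF d has_derivative_norm[OF ne]] by simp
    have "((\<lambda>y. norm (y $ i - y $ j) powr (- \<alpha>)) has_derivative
        (\<lambda>h. norm (x $ i - x $ j) powr (- \<alpha>) * (0 * ln (norm (x $ i - x $ j)) +
            ((h $ i - h $ j) \<bullet> sgn (x $ i - x $ j)) * (- \<alpha>) / norm (x $ i - x $ j)))) (at x)"
      using ne by (intro has_derivative_powr n has_derivative_const) auto
    then have "((\<lambda>y. m i * m j * norm (y $ i - y $ j) powr (- \<alpha>)) has_derivative
        (\<lambda>h. m i * m j * (norm (x $ i - x $ j) powr (- \<alpha>) * (0 * ln (norm (x $ i - x $ j)) +
            ((h $ i - h $ j) \<bullet> sgn (x $ i - x $ j)) * (- \<alpha>) / norm (x $ i - x $ j))))) (at x)"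
      by (rule has_derivative_mult_right)
    moreover have "norm z powr (- \<alpha>) * (0 * ln (norm z) + (w \<bullet> sgn z) * (- \<alpha>) / norm z)
        = - \<alpha> * norm z powr (- \<alpha> - 2) * (z \<bullet> w)" if "z \<noteq> 0" for z w :: "real ^ 'd"
      using that by (simp add: powr_diff sgn_div_norm inner_commute power2_eq_square field_simps)
    from this[OF ne] have "norm (x $ i - x $ j) powr (- \<alpha>) * (0 * ln (norm (x $ i - x $ j)) +
            ((h $ i - h $ j) \<bullet> sgn (x $ i - x $ j)) * (- \<alpha>) / norm (x $ i - x $ j))
          = - \<alpha> * norm (x $ i - x $ j) powr (- \<alpha> - 2) * ((x $ i - x $ j) \<bullet> (h $ i - h $ j))" for h
      .
    ultimately show ?thesis by (simp only:)
  qed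
  show ?thesis
    unfolding potential_def[abs_def] potential_differential_def[abs_def]
    by (rule has_derivative_sum) (use pair in auto)
qed

lemma potential_gradient_inner:
  assumes "x \<notin> collisions" and "GDERIV (potential \<alpha> m) x :> D"
  shows "D \<bullet> h = potential_differential \<alpha> m x h"
proof -
  have "(\<lambda>h. h \<bullet> D) = potential_differential \<alpha> m x"
    using assms(2) potential_has_derivative[OF assms(1), of \<alpha> m] unfolding gderiv_def
    by (rule has_derivative_unique)
  then show ?thesis by (metis inner_commute)
qed

text \<open>Euler's identity for the homogeneous potential.\<close>

lemma potential_differential_self:
  assumes "x \<notin> collisions"
  shows "potential_differential \<alpha> m x x = - \<alpha> * potential \<alpha> m x"
proof -
  have "m i * m j * (- \<alpha> * norm (x $ i - x $ j) powr (- \<alpha> - 2) * ((x $ i - x $ j) \<bullet> (x $ i - x $ j)))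
      = - \<alpha> * (m i * m j * norm (x $ i - x $ j) powr (- \<alpha>))" if "i < j" for i j
  proof -
    have "x $ i - x $ j \<noteq> 0" using assms that by (metis not_collision_iff less_irrefl right_minus_eq)
    then show ?thesis
      by (simp add: powr_diff power2_norm_eq_inner[symmetric])
  qed
  then show ?thesis
    unfolding potential_differential_def potential_def sum_distrib_left
    by (intro sum.cong) auto
qed

context
  fixes m :: "'n::{finite,linorder} \<Rightarrow> real"
  assumes m: "\<And>i. m i > 0"
begin

lemma potential_nonneg: "potential \<alpha> m x \<ge> 0"
  unfolding potential_def using m[THEN less_imp_le] by (intro sum_nonneg) (auto intro!: mult_nonneg_nonneg)

lemma potential_above_tangent:
  fixes x w :: "real ^ 'd ^ 'n::{finite,linorder}"
  assumes "x \<notin> collisions" "x + w \<notin> collisions" "\<alpha> > 0"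
  shows "potential \<alpha> m (x + w) \<ge> potential \<alpha> m x + potential_differential \<alpha> m x w
     - \<alpha> / 2 * (\<Sum>(i, j)\<in>{(i, j). i < j}. m i * m j * (norm (x $ i - x $ j) powr (- \<alpha> - 2) * (norm (w $ i - w $ j))\<^sup>2))"
    (is "_ \<ge> ?P + ?D - ?R")
proof -
  let ?f = "\<lambda>i j. m i * m j * norm (x $ i - x $ j) powr (- \<alpha>)
       + m i * m j * (- \<alpha> * norm (x $ i - x $ j) powr (- \<alpha> - 2) * ((x $ i - x $ j) \<bullet> (w $ i - w $ j)))
       - \<alpha> / 2 * (m i * m j * (norm (x $ i - x $ j) powr (- \<alpha> - 2) * (norm (w $ i - w $ j))\<^sup>2))"
  have "?P + ?D - ?R = (\<Sum>(i, j)\<in>{(i, j). i < j}. ?f i j)"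
    unfolding potential_def potential_differential_def sum_distrib_left
    by (simp add: sum.distrib[symmetric] sum_subtractf[symmetric] case_prod_beta)
  also have "\<dots> \<le> potential \<alpha> m (x + w)"
    unfolding potential_def
  proof (intro sum_mono, clarsimp)
    fix i j :: 'n assume ij: "i < j"
    let ?z = "x $ i - x $ j" and ?w = "w $ i - w $ j"
    have e: "x $ i + w $ i - (x $ j + w $ j) = ?z + ?w" by simp
    have "?z \<noteq> 0" "?z + ?w \<noteq> 0"
      using assms ij unfolding e[symmetric] by (auto simp: not_collision_iff)
    from norm_powr_above_tangent[OF this \<open>\<alpha> > 0\<close>]
    have "m i * m j * (norm ?z powr (- \<alpha>) - \<alpha> * norm ?z powr (- \<alpha> - 2) * (?z \<bullet> ?w)
     - \<alpha> / 2 * norm ?z powr (- \<alpha> - 2) * (norm ?w)\<^sup>2) \<le> m i * m j * norm (?z + ?w) powr (- \<alpha>)"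
      using m[of i] m[of j] by (intro mult_left_mono) auto
    moreover have "?f i j = m i * m j * (norm ?z powr (- \<alpha>) - \<alpha> * norm ?z powr (- \<alpha> - 2) * (?z \<bullet> ?w)
     - \<alpha> / 2 * norm ?z powr (- \<alpha> - 2) * (norm ?w)\<^sup>2)" by (simp add: algebra_simps)
    ultimately have "?f i j \<le> m i * m j * norm (x $ i + w $ i - (x $ j + w $ j)) powr (- \<alpha>)"
      unfolding e by simp
    then show "m i * m j * norm ?z powr - \<alpha> - m i * m j * (\<alpha> * norm ?z powr (- \<alpha> - 2) * (?z \<bullet> ?w))
        - \<alpha> * (m i * m j * (norm ?z powr (- \<alpha> - 2) * (norm ?w)\<^sup>2)) / 2
        \<le> m i * m j * norm (x $ i + w $ i - (x $ j + w $ j)) powr - \<alpha>"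
      by simp
  qed
  finally show ?thesis .
qed

text \<open>One constant serves all \<open>\<alpha> \<le> 1\<close>; this and the same uniformity in the next lemma are what allow a common bound
  on \<open>\<alpha>\<close>.\<close>

lemma potential_lower_bound:
  assumes "CARD('n) \<ge> 2"
  shows "\<exists>b>0. \<forall>\<alpha>\<in>{0<..1}. \<forall>x :: real ^ 'd ^ 'n::{finite,linorder}. x \<notin> collisions \<longrightarrow>
      b * mnorm m x powr (- \<alpha>) \<le> potential \<alpha> m x"
proof -
  obtain i j :: 'n where ij: "i < j" using exists_two_bodies[OF assms] .
  \<comment> \<open>The summand \<open>1\<close> makes \<open>C \<ge> 1\<close>, hence \<open>C\<^bsup>-\<alpha>\<^esup> \<ge> 1 / C\<close> for all \<open>\<alpha> \<le> 1\<close>.\<close>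
  define C where "C = 1 + 1 / sqrt (m i) + 1 / sqrt (m j)"
  have C: "C \<ge> 1" using m[of i] m[of j] by (simp add: C_def)
  show ?thesis
  proof (intro exI[of _ "m i * m j / C"] conjI ballI allI impI)
    show "0 < m i * m j / C" using m[of i] m[of j] C by simp
    fix \<alpha> :: real and x :: "real ^ 'd ^ 'n::{finite,linorder}" assume \<alpha>: "\<alpha> \<in> {0<..1}" and x: "x \<notin> collisions"
    have body: "norm (x $ k) \<le> mnorm m x / sqrt (m k)" for k
    proof -
      have "(sqrt (m k) * norm (x $ k))\<^sup>2 \<le> (mnorm m x)\<^sup>2"
        using body_le_mnorm[where m = m and i = k and y = x, OF m] m[of k] by (simp add: power_mult_distrib)
      then have "sqrt (m k) * norm (x $ k) \<le> mnorm m x"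
        by (rule power2_le_imp_le) (rule mnorm_nonneg[OF m])
      then show ?thesis using m[of k] by (simp add: field_simps)
    qed
    have ne: "x $ i \<noteq> x $ j" using x ij by (auto simp: not_collision_iff)
    have "norm (x $ i - x $ j) \<le> norm (x $ i) + norm (x $ j)" by (rule norm_triangle_ineq4)
    also have "\<dots> \<le> mnorm m x / sqrt (m i) + mnorm m x / sqrt (m j)" by (intro add_mono body)
    also have "\<dots> \<le> C * mnorm m x" using mnorm_nonneg[where m = m, OF m, of x] by (simp add: C_def algebra_simps)
    finally have le: "norm (x $ i - x $ j) \<le> C * mnorm m x" .
    have "C powr (- 1) \<le> C powr (- \<alpha>)" using C \<alpha> by (intro powr_mono) auto
    then have "1 / C \<le> C powr (- \<alpha>)" using C by (simp add: powr_minus_divide)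
    then have "m i * m j * (1 / C * mnorm m x powr (- \<alpha>)) \<le> m i * m j * (C powr (- \<alpha>) * mnorm m x powr (- \<alpha>))"
      using m[of i] m[of j] by (intro mult_left_mono mult_right_mono) auto
    also have "C powr (- \<alpha>) * mnorm m x powr (- \<alpha>) = (C * mnorm m x) powr (- \<alpha>)"
      by (rule powr_mult[symmetric])
    also have "m i * m j * (C * mnorm m x) powr (- \<alpha>) \<le> m i * m j * norm (x $ i - x $ j) powr (- \<alpha>)"
      using m[of i] m[of j] le ne \<alpha> by (intro mult_left_mono powr_mono2') auto
    also have "\<dots> = (\<Sum>(i, j)\<in>{(i, j)}. m i * m j * norm (x $ i - x $ j) powr (- \<alpha>))" by simp
    also have "\<dots> \<le> potential \<alpha> m x"
      unfolding potential_def using ij m[THEN less_imp_le]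
      by (intro sum_mono2) (auto intro!: mult_nonneg_nonneg)
    finally show "m i * m j / C * mnorm m x powr (- \<alpha>) \<le> potential \<alpha> m x" by simp
  qed
qed

lemma pair_sum_bound:
  assumes "c > 0"
  obtains C where "C > 0"
    and "\<And>\<alpha> (x :: real ^ 'd ^ 'n::{finite,linorder}) (w :: real ^ 'd ^ 'n::{finite,linorder}).
      \<alpha> \<in> {0<..1} \<Longrightarrow> mnorm m x > 0 \<Longrightarrow>
      \<forall>i j. i \<noteq> j \<longrightarrow> c * mnorm m x \<le> norm (x $ i - x $ j) \<Longrightarrow>
      (\<Sum>(i, j)\<in>{(i, j). i < j}. m i * m j * (norm (x $ i - x $ j) powr (- \<alpha> - 2) * (norm (w $ i - w $ j))\<^sup>2))
       \<le> C * mnorm m x powr (- \<alpha> - 2) * (mnorm m w)\<^sup>2"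
proof -
  \<comment> \<open>A base at most \<open>1\<close> lets \<open>e\<^bsup>-\<alpha>-2\<^esup>\<close> be bounded by \<open>e\<^bsup>-3\<^esup>\<close> for all \<open>\<alpha> \<le> 1\<close>.\<close>
  define e where "e = min c 1"
  have e: "0 < e" "e \<le> 1" "e \<le> c" using assms by (auto simp: e_def)
  define C where "C = 1 + (\<Sum>(i, j)\<in>{(i, j::'n). i < j}. e powr (- 3) * (2 * (m i + m j)))"
  have Cpos: "C > 0"
    unfolding C_def using m[THEN less_imp_le]
    by (intro add_pos_nonneg sum_nonneg) (auto intro!: mult_nonneg_nonneg add_nonneg_nonneg)
  have main: "(\<Sum>(i, j)\<in>{(i, j). i < j}. m i * m j * (norm (x $ i - x $ j) powr (- \<alpha> - 2) * (norm (w $ i - w $ j))\<^sup>2))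
       \<le> C * mnorm m x powr (- \<alpha> - 2) * (mnorm m w)\<^sup>2"
    if \<alpha>: "\<alpha> \<in> {0<..1}" and r: "mnorm m x > 0"
      and sep: "\<forall>i j. i \<noteq> j \<longrightarrow> c * mnorm m x \<le> norm (x $ i - x $ j)"
    for \<alpha> and x w :: "real ^ 'd ^ 'n::{finite,linorder}"
  proof -
    have pair: "m i * m j * (norm (x $ i - x $ j) powr (- \<alpha> - 2) * (norm (w $ i - w $ j))\<^sup>2)
        \<le> e powr (- 3) * (2 * (m i + m j)) * (mnorm m x powr (- \<alpha> - 2) * (mnorm m w)\<^sup>2)" if ij: "i < j" for i j
    proof -
      have "e * mnorm m x \<le> c * mnorm m x" using e r by simp
      also have "\<dots> \<le> norm (x $ i - x $ j)" using sep ij by simp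
      finally have "norm (x $ i - x $ j) powr (- \<alpha> - 2) \<le> (e * mnorm m x) powr (- \<alpha> - 2)"
        using e r \<alpha> by (intro powr_mono2') auto
      also have "\<dots> = e powr (- \<alpha> - 2) * mnorm m x powr (- \<alpha> - 2)" by (rule powr_mult)
      also have "\<dots> \<le> e powr (- 3) * mnorm m x powr (- \<alpha> - 2)"
        using e \<alpha> by (intro mult_right_mono powr_mono') auto
      finally have 1: "norm (x $ i - x $ j) powr (- \<alpha> - 2) \<le> e powr (- 3) * mnorm m x powr (- \<alpha> - 2)" .
      have "(norm (w $ i - w $ j))\<^sup>2 \<le> (norm (w $ i) + norm (w $ j))\<^sup>2"
        by (intro power_mono norm_triangle_ineq4) auto
      also have "\<dots> \<le> 2 * (norm (w $ i))\<^sup>2 + 2 * (norm (w $ j))\<^sup>2"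
        using sum_squares_bound[of "norm (w $ i)" "norm (w $ j)"] by (simp add: power2_sum)
      finally have "m i * m j * (norm (w $ i - w $ j))\<^sup>2 \<le> m i * m j * (2 * (norm (w $ i))\<^sup>2 + 2 * (norm (w $ j))\<^sup>2)"
        using m[of i] m[of j] by (intro mult_left_mono) auto
      also have "\<dots> = 2 * m j * (m i * (norm (w $ i))\<^sup>2) + 2 * m i * (m j * (norm (w $ j))\<^sup>2)"
        by (simp add: algebra_simps)
      also have "\<dots> \<le> 2 * m j * (mnorm m w)\<^sup>2 + 2 * m i * (mnorm m w)\<^sup>2"
        using m[of i] m[of j] by (intro add_mono mult_left_mono body_le_mnorm[OF m]) auto
      finally have 2: "m i * m j * (norm (w $ i - w $ j))\<^sup>2 \<le> 2 * (m i + m j) * (mnorm m w)\<^sup>2"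
        by (simp add: algebra_simps)
      have "norm (x $ i - x $ j) powr (- \<alpha> - 2) * (m i * m j * (norm (w $ i - w $ j))\<^sup>2)
        \<le> (e powr (- 3) * mnorm m x powr (- \<alpha> - 2)) * (2 * (m i + m j) * (mnorm m w)\<^sup>2)"
        using m[of i] m[of j] by (intro mult_mono 1 2) auto
      then show ?thesis by (simp add: mult_ac)
    qed
    have "(\<Sum>(i, j)\<in>{(i, j). i < j}. m i * m j * (norm (x $ i - x $ j) powr (- \<alpha> - 2) * (norm (w $ i - w $ j))\<^sup>2))
       \<le> (\<Sum>(i, j)\<in>{(i, j). i < j}. e powr (- 3) * (2 * (m i + m j)) * (mnorm m x powr (- \<alpha> - 2) * (mnorm m w)\<^sup>2))"
      by (intro sum_mono) (use pair in auto)
    also have "\<dots> = (C - 1) * (mnorm m x powr (- \<alpha> - 2) * (mnorm m w)\<^sup>2)"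
      by (simp add: C_def sum_distrib_right case_prod_beta)
    also have "\<dots> \<le> C * (mnorm m x powr (- \<alpha> - 2) * (mnorm m w)\<^sup>2)"
      by (intro mult_right_mono) auto
    finally show ?thesis by (simp add: mult.assoc)
  qed
  show thesis by (rule that[OF Cpos main])
qed

end

section \<open>The rate of a total collapse\<close>

text \<open>In the application \<open>I\<close> is the moment of inertia, so the conclusion reads
  \<open>\<surd>b (1 - t) \<le> r\<^bsup>1+\<alpha>/2\<^esup>\<close>.\<close>

lemma power_law_collapse_rate:
  fixes I I' I'' :: "real \<Rightarrow> real"
  assumes \<alpha>: "0 < \<alpha>" "\<alpha> < 2" and b: "0 < b"
    and dI: "\<And>t. c < t \<Longrightarrow> t < 1 \<Longrightarrow> (I has_real_derivative I' t) (at t)"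
    and dI': "\<And>t. c < t \<Longrightarrow> t < 1 \<Longrightarrow> (I' has_real_derivative I'' t) (at t)"
    and pos: "\<And>t. c < t \<Longrightarrow> t < 1 \<Longrightarrow> I t > 0"
    and lim: "(I \<longlongrightarrow> 0) (at_left 1)"
    and conv: "\<And>t. c < t \<Longrightarrow> t < 1 \<Longrightarrow> I'' t \<ge> (2 - \<alpha>) * b * I t powr (- \<alpha> / 2)"
    and t: "c < t" "t < 1"
  shows "sqrt b * (1 - t) \<le> I t powr (1 / 2 + \<alpha> / 4)"
proof -
  have ev: "eventually (\<lambda>s. t0 < s \<and> s < 1) (at_left (1::real))" if "t0 < 1" for t0
    using that by (auto simp: eventually_at_left[of 0] intro!: exI[of _ "max t0 0"])
  have I''pos: "I'' s > 0" if "c < s" "s < 1" for s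
  proof -
    have "0 < (2 - \<alpha>) * b * I s powr (- \<alpha> / 2)"
      using \<alpha> b pos[OF that] by simp
    also have "\<dots> \<le> I'' s" by (rule conv[OF that])
    finally show ?thesis .
  qed
  have I'mono: "I' s \<le> I' r" if "c < s" "s \<le> r" "r < 1" for s r
  proof (rule DERIV_nonneg_imp_nondecreasing[OF that(2)])
    fix y assume "s \<le> y" "y \<le> r"
    then show "\<exists>z. (I' has_real_derivative z) (at y) \<and> 0 \<le> z"
      using that dI'[of y] I''pos[of y] by (intro exI[of _ "I'' y"]) auto
  qed
  have I'neg: "I' s < 0" if s: "c < s" "s < 1" for s
  proof (rule ccontr)
    assume "\<not> I' s < 0"
    have "I s \<le> I r" if r: "s < r" "r < 1" for r
    proof (rule DERIV_nonneg_imp_nondecreasing[OF less_imp_le[OF r(1)]])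
      fix y assume y: "s \<le> y" "y \<le> r"
      have "0 \<le> I' y" using I'mono[of s y] y r s \<open>\<not> I' s < 0\<close> by linarith
      then show "\<exists>z. (I has_real_derivative z) (at y) \<and> 0 \<le> z"
        using dI[of y] y s r by (intro exI[of _ "I' y"]) auto
    qed
    then have "eventually (\<lambda>r. I s \<le> I r) (at_left 1)"
      using ev[OF s(2)] by (auto elim: eventually_mono)
    then have "I s \<le> 0"
      by (rule tendsto_lowerbound[OF lim]) simp
    with pos[OF s] show False by simp
  qed
  \<comment> \<open>the energy of the comparison equation\<close>
  define H where "H s = (I' s)\<^sup>2 / 2 - 2 * b * I s powr (1 - \<alpha> / 2)" for s
  have dH: "(H has_real_derivative I' s * (I'' s - (2 - \<alpha>) * b * I s powr (- \<alpha> / 2))) (at s)"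
    if "c < s" "s < 1" for s
    unfolding H_def
    using pos[OF that]
    by (auto intro!: derivative_eq_intros dI[OF that] dI'[OF that] simp: algebra_simps)
  have Hdec: "H r \<le> H s" if "c < s" "s \<le> r" "r < 1" for s r
  proof (rule DERIV_nonpos_imp_nonincreasing[OF that(2)])
    fix y assume y: "s \<le> y" "y \<le> r"
    have "I' y * (I'' y - (2 - \<alpha>) * b * I y powr (- \<alpha> / 2)) \<le> 0"
      using I'neg[of y] conv[of y] y that by (intro mult_nonpos_nonneg) auto
    then show "\<exists>z. (H has_real_derivative z) (at y) \<and> z \<le> 0"
      using dH[of y] y that by auto
  qed
  have Hnonneg: "H s \<ge> 0" if s: "c < s" "s < 1" for s
  proof -
    have "((\<lambda>r. - 2 * b * I r powr (1 - \<alpha> / 2)) \<longlongrightarrow> - 2 * b * 0 powr (1 - \<alpha> / 2)) (at_left 1)"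
    proof (intro tendsto_mult tendsto_const tendsto_powr'[OF lim])
      show "(0::real) \<noteq> 0 \<or> 0 < 1 - \<alpha> / 2 \<and> (\<forall>\<^sub>F r in at_left 1. 0 \<le> I r)"
      proof -
        have "\<forall>\<^sub>F r in at_left 1. 0 \<le> I r"
          using ev[OF s(2)] pos s by (auto elim!: eventually_mono intro: less_imp_le)
        then show ?thesis using \<alpha> by simp
      qed
    qed
    then have "((\<lambda>r. - 2 * b * I r powr (1 - \<alpha> / 2)) \<longlongrightarrow> 0) (at_left 1)" by simp
    moreover have "eventually (\<lambda>r. - 2 * b * I r powr (1 - \<alpha> / 2) \<le> H s) (at_left 1)"
      using ev[OF s(2)]
    proof eventually_elim
      case (elim r)
      have "- 2 * b * I r powr (1 - \<alpha> / 2) \<le> H r" by (simp add: H_def)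
      also have "\<dots> \<le> H s" using elim s by (intro Hdec) auto
      finally show ?case .
    qed
    ultimately show ?thesis by (rule tendsto_upperbound) simp
  qed
  have I'bound: "I' s \<le> - 2 * sqrt b * I s powr (1 / 2 - \<alpha> / 4)" if s: "c < s" "s < 1" for s
  proof -
    have "(2 * sqrt b * I s powr (1 / 2 - \<alpha> / 4))\<^sup>2 = 4 * b * (I s powr (1 / 2 - \<alpha> / 4))\<^sup>2"
      using b by (simp add: power_mult_distrib)
    also have "(I s powr (1 / 2 - \<alpha> / 4))\<^sup>2 = I s powr (1 - \<alpha> / 2)"
      using pos[OF s] by (simp add: power2_eq_square flip: powr_add)
    finally have "(2 * sqrt b * I s powr (1 / 2 - \<alpha> / 4))\<^sup>2 \<le> (- I' s)\<^sup>2"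
      using Hnonneg[OF s] by (simp add: H_def)
    then have "2 * sqrt b * I s powr (1 / 2 - \<alpha> / 4) \<le> - I' s"
      by (rule power2_le_imp_le) (use I'neg[OF s] in simp)
    then show ?thesis by simp
  qed
  define G where "G s = I s powr (1 / 2 + \<alpha> / 4) + sqrt b * s" for s
  have dG: "(G has_real_derivative (1 / 2 + \<alpha> / 4) * I s powr (\<alpha> / 4 - 1 / 2) * I' s + sqrt b) (at s)"
    if "c < s" "s < 1" for s
    unfolding G_def
    using pos[OF that]
    by (auto intro!: derivative_eq_intros dI[OF that] simp: algebra_simps)
  have dGneg: "(1 / 2 + \<alpha> / 4) * I s powr (\<alpha> / 4 - 1 / 2) * I' s + sqrt b \<le> 0" if s: "c < s" "s < 1" for s
  proof -
    have "(1 / 2 + \<alpha> / 4) * I s powr (\<alpha> / 4 - 1 / 2) * I' s \<le>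
      (1 / 2 + \<alpha> / 4) * I s powr (\<alpha> / 4 - 1 / 2) * (- 2 * sqrt b * I s powr (1 / 2 - \<alpha> / 4))"
      using I'bound[OF s] \<alpha> by (intro mult_left_mono) auto
    also have "\<dots> = - (1 + \<alpha> / 2) * sqrt b * (I s powr (\<alpha> / 4 - 1 / 2) * I s powr (1 / 2 - \<alpha> / 4))"
      by (simp add: algebra_simps)
    also have "I s powr (\<alpha> / 4 - 1 / 2) * I s powr (1 / 2 - \<alpha> / 4) = 1"
      using pos[OF s] by (simp flip: powr_add)
    also have "- (1 + \<alpha> / 2) * sqrt b * 1 \<le> - sqrt b" using \<alpha> b by (simp add: algebra_simps)
    finally show ?thesis by simp
  qed
  have Gdec: "G r \<le> G s" if "c < s" "s \<le> r" "r < 1" for s r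
  proof (rule DERIV_nonpos_imp_nonincreasing[OF that(2)])
    fix y assume "s \<le> y" "y \<le> r"
    then show "\<exists>z. (G has_real_derivative z) (at y) \<and> z \<le> 0"
      using dG[of y] dGneg[of y] that by auto
  qed
  have "((\<lambda>r. sqrt b * r) \<longlongrightarrow> sqrt b * 1) (at_left 1)" by (intro tendsto_intros)
  moreover have "eventually (\<lambda>r. sqrt b * r \<le> G t) (at_left 1)"
    using ev[OF t(2)]
  proof eventually_elim
    case (elim r)
    have "sqrt b * r \<le> G r" by (simp add: G_def)
    also have "\<dots> \<le> G t" using elim t by (intro Gdec) auto
    finally show ?case .
  qed
  ultimately have "sqrt b * 1 \<le> G t" by (rule tendsto_upperbound) simp
  then show ?thesis by (simp add: G_def algebra_simps)
qed

lemma mass_inner_has_real_derivative: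
  fixes m :: "'n::finite \<Rightarrow> real"
  assumes u: "(u has_vector_derivative u') (at t)" and v: "(v has_vector_derivative v') (at t)"
  shows "((\<lambda>t. mass_mult m (u t) \<bullet> v t) has_real_derivative mass_mult m (u t) \<bullet> v' + mass_mult m u' \<bullet> v t) (at t)"
proof -
  have "((\<lambda>t. mass_mult m (u t)) has_vector_derivative mass_mult m u') (at t)"
    using bounded_linear.has_vector_derivative[OF bounded_linear_mass_mult u] .
  from bounded_bilinear.has_vector_derivative[OF bounded_bilinear_inner this v]
  show ?thesis by (simp add: has_real_derivative_iff_has_vector_derivative)
qed

lemma potential_along_path_has_real_derivative:
  assumes "GDERIV (potential \<alpha> m) (x t) :> D" and "(x has_vector_derivative v) (at t)"
  shows "((\<lambda>t. potential \<alpha> m (x t)) has_real_derivative D \<bullet> v) (at t)"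
proof -
  have "((\<lambda>t. potential \<alpha> m (x t)) has_derivative (\<lambda>s. (s *\<^sub>R v) \<bullet> D)) (at t)"
    using assms unfolding gderiv_def has_vector_derivative_def by (rule has_derivative_compose[rotated])
  then show ?thesis by (simp add: has_field_derivative_def inner_commute mult.commute[of _ "D \<bullet> v"])
qed

text \<open>Here \<open>b\<close> is a constant as in \<open>potential_lower_bound\<close>. The shape need not converge: with \<open>e\<close> the energy, the
  Lagrange-Jacobi identity \<open>I'' = 4 e + 2 (2 - \<alpha>) U\<close> and \<open>U \<rightarrow> \<infinity>\<close> suffice.\<close>

lemma total_collision_lower_rate:
  fixes m :: "'n::{finite,linorder} \<Rightarrow> real" and x :: "real \<Rightarrow> real ^ 'd ^ 'n::{finite,linorder}"
  assumes card: "CARD('n) \<ge> 2" and m: "\<And>i. m i > 0" and \<alpha>: "\<alpha> \<in> {0<..1}" and b: "b > 0"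
    and lower: "\<And>y :: real ^ 'd ^ 'n::{finite,linorder}. y \<notin> collisions \<Longrightarrow> b * mnorm m y powr (- \<alpha>) \<le> potential \<alpha> m y"
    and sol: "total_collision_solution \<alpha> m x"
  shows "\<forall>\<^sub>F t in at_left 1. b * (1 - t)\<^sup>2 \<le> mnorm m (x t) powr (\<alpha> + 2)"
proof -
  from sol obtain x' x'' where
    cont: "continuous_on {0..1} x" and ncoll: "\<And>t. t \<in> {0..<1} \<Longrightarrow> x t \<notin> collisions"
    and x1: "x 1 = 0"
    and dx: "\<And>t. t \<in> {0<..<1} \<Longrightarrow> (x has_vector_derivative x' t) (at t)"
    and dx': "\<And>t. t \<in> {0<..<1} \<Longrightarrow> (x' has_vector_derivative x'' t) (at t)"
    and newton: "\<And>t. t \<in> {0<..<1} \<Longrightarrow> GDERIV (potential \<alpha> m) (x t) :> mass_mult m (x'' t)"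
    unfolding total_collision_solution_def by blast
  define I where "I t = mass_mult m (x t) \<bullet> x t" for t
  define I' where "I' t = 2 * (mass_mult m (x t) \<bullet> x' t)" for t
  define I'' where "I'' t = 2 * (mass_mult m (x' t) \<bullet> x' t) + 2 * (mass_mult m (x'' t) \<bullet> x t)" for t
  have dI: "(I has_real_derivative I' t) (at t)" if "t \<in> {0<..<1}" for t
    using mass_inner_has_real_derivative[OF dx[OF that] dx[OF that], of m]
    by (simp add: I_def[abs_def] I'_def mass_inner_commute[of m "x' t"])
  have dI': "(I' has_real_derivative I'' t) (at t)" if "t \<in> {0<..<1}" for t
    using DERIV_cmult[OF mass_inner_has_real_derivative[OF dx[OF that] dx'[OF that], of m], of 2]
    by (simp add: I'_def[abs_def] I''_def mass_inner_commute[of m "x t"] algebra_simps)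
  \<comment> \<open>the total energy\<close>
  define h where "h t = (1/2) * (mass_mult m (x' t) \<bullet> x' t) - potential \<alpha> m (x t)" for t
  have dh: "(h has_real_derivative 0) (at t)" if "t \<in> {0<..<1}" for t
  proof -
    have "(h has_real_derivative (1/2) * (mass_mult m (x' t) \<bullet> x'' t + mass_mult m (x'' t) \<bullet> x' t) -
        mass_mult m (x'' t) \<bullet> x' t) (at t)"
      unfolding h_def[abs_def]
      by (intro DERIV_diff DERIV_cmult mass_inner_has_real_derivative
          potential_along_path_has_real_derivative dx dx' newton that)
    then show ?thesis by (simp add: mass_inner_commute[of m "x' t"])
  qed
  then obtain e where e: "\<And>t. t \<in> {0<..<1} \<Longrightarrow> h t = e"
    using has_field_derivative_zero_constant[of "{0<..<1}" h]
    by (metis convex_real_interval(8) has_field_derivative_at_within)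
  have lagrange_jacobi: "I'' t = 4 * e + 2 * (2 - \<alpha>) * potential \<alpha> m (x t)" if t: "t \<in> {0<..<1}" for t
  proof -
    have "mass_mult m (x'' t) \<bullet> x t = - \<alpha> * potential \<alpha> m (x t)"
      using potential_gradient_inner[OF _ newton[OF t]] potential_differential_self ncoll t
      by (metis atLeastLessThan_iff greaterThanLessThan_iff less_imp_le)
    then show ?thesis using e[OF t] by (simp add: I''_def h_def algebra_simps)
  qed
  have r: "mnorm m (x t) powr p = I t powr (p / 2)" for t p
  proof -
    have "I t powr (p / 2) = ((mnorm m (x t)) powr 2) powr (p / 2)"
      using mnorm_nonneg[where m = m, OF m, of "x t"] mnorm_power2[where m = m, OF m, of "x t"] by (simp add: I_def)
    then show ?thesis by (simp add: powr_powr)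
  qed
  have Ipos: "I t > 0" if t: "t \<in> {0<..<1}" for t
  proof -
    have "x t \<noteq> 0"
    proof
      assume "x t = 0"
      then have "x t \<in> collisions" using zero_in_collisions[OF card] by simp
      then show False using ncoll t by auto
    qed
    then show ?thesis using mnorm_pos[where m = m, OF m, of "x t"] mnorm_power2[where m = m, OF m, of "x t"]
      by (metis I_def zero_less_power)
  qed
  have "continuous_on {0..1} I"
    unfolding I_def by (intro mass_inner_continuous cont)
  from continuous_on_Icc_at_leftD[OF this] have lim: "(I \<longlongrightarrow> 0) (at_left 1)"
    by (simp add: I_def x1)
  \<comment> \<open>For \<open>I < c\<close> the potential exceeds \<open>4 \<bar>e\<bar>\<close>, which absorbs the energy constant in the identity above.\<close>
  define c where "c = (b / (4 * \<bar>e\<bar> + 1)) powr (2 / \<alpha>)"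
  have c: "c > 0" using b by (simp add: c_def)
  have ev: "\<forall>\<^sub>F t in at_left 1. I t < c" using lim c by (rule order_tendstoD)
  then obtain \<tau> where \<tau>: "\<tau> < 1" "\<And>t. \<tau> < t \<Longrightarrow> t < 1 \<Longrightarrow> I t < c"
    unfolding eventually_at_left[of 0, OF zero_less_one] by blast
  define \<tau>' where "\<tau>' = max 0 \<tau>"
  have convex: "I'' t \<ge> (2 - \<alpha>) * b * I t powr (- \<alpha> / 2)" if t: "\<tau>' < t" "t < 1" for t
  proof -
    have t': "t \<in> {0<..<1}" "I t < c" using t \<tau> by (auto simp: \<tau>'_def)
    have low: "b * I t powr (- \<alpha> / 2) \<le> potential \<alpha> m (x t)"
      using lower[of "x t"] ncoll t' by (simp add: r)
    have "(4 * \<bar>e\<bar> + 1) / b = c powr (- \<alpha> / 2)"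
      using b \<alpha> by (simp add: c_def powr_powr powr_minus_divide)
    also have "\<dots> \<le> I t powr (- \<alpha> / 2)"
      using Ipos[OF t'(1)] t'(2) \<alpha> by (intro powr_mono2') auto
    finally have "4 * \<bar>e\<bar> + 1 \<le> b * I t powr (- \<alpha> / 2)" using b by (simp add: field_simps)
    then have U: "4 * \<bar>e\<bar> \<le> potential \<alpha> m (x t)" using low by linarith
    then have "4 * \<bar>e\<bar> \<le> (2 - \<alpha>) * potential \<alpha> m (x t)"
      using \<alpha> mult_right_mono[of 1 "2 - \<alpha>" "potential \<alpha> m (x t)"] abs_ge_zero[of e]
      by (auto simp del: abs_ge_zero)
    moreover have "(2 - \<alpha>) * (b * I t powr (- \<alpha> / 2)) \<le> (2 - \<alpha>) * potential \<alpha> m (x t)"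
      using low \<alpha> by (intro mult_left_mono) auto
    ultimately show ?thesis unfolding lagrange_jacobi[OF t'(1)] mult.assoc by linarith
  qed
  have "b * (1 - t)\<^sup>2 \<le> mnorm m (x t) powr (\<alpha> + 2)" if t: "\<tau>' < t" "t < 1" for t
  proof -
    have "sqrt b * (1 - t) \<le> I t powr (1 / 2 + \<alpha> / 4)"
    proof (rule power_law_collapse_rate[OF _ _ b _ _ _ lim convex t])
      show "0 < \<alpha>" "\<alpha> < 2" using \<alpha> by auto
    qed (auto intro!: dI dI' Ipos simp: \<tau>'_def)
    then have "(sqrt b * (1 - t))\<^sup>2 \<le> (I t powr (1 / 2 + \<alpha> / 4))\<^sup>2"
      using b t by (intro power_mono) auto
    also have "(sqrt b * (1 - t))\<^sup>2 = b * (1 - t)\<^sup>2" using b by (simp add: power_mult_distrib)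
    also have "(I t powr (1 / 2 + \<alpha> / 4))\<^sup>2 = I t powr ((1 / 2 + \<alpha> / 4) + (1 / 2 + \<alpha> / 4))"
      by (simp only: power2_eq_square powr_add)
    also have "(1 / 2 + \<alpha> / 4) + (1 / 2 + \<alpha> / 4) = (\<alpha> + 2) / 2" by (simp add: field_simps)
    finally show ?thesis by (simp add: r)
  qed
  moreover have "\<tau>' < 1" using \<tau> by (simp add: \<tau>'_def)
  ultimately show ?thesis unfolding eventually_at_left[of 0, OF zero_less_one] by blast
qed

section \<open>The action\<close>

lemma has_integral_of_nn_integral:
  fixes f :: "real \<Rightarrow> real"
  assumes m: "f \<in> borel_measurable lebesgue" and nonneg: "\<And>t. 0 \<le> f t" and "0 \<le> J"
    and J: "(\<integral>\<^sup>+t. ennreal (f t) \<partial>lebesgue) = ennreal J"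
  shows "(f has_integral J) UNIV"
proof -
  have i: "integrable lebesgue f"
    by (rule integrableI_nonneg) (use assms in auto)
  have "ennreal (integral\<^sup>L lebesgue f) = ennreal J"
    using nn_integral_eq_integral[OF i] nonneg J by auto
  then have "integral\<^sup>L lebesgue f = J"
    using \<open>0 \<le> J\<close> nonneg by (simp add: ennreal_inj integral_nonneg)
  then show ?thesis using has_integral_integral_lebesgue[OF i] by simp
qed

text \<open>The function \<open>f\<close> may change sign; negative values count as \<open>0\<close> on the right.\<close>

lemma ennreal_integral_le_nn_integral:
  fixes f :: "real \<Rightarrow> real"
  assumes I: "(f has_integral I) S" and S: "S \<in> sets lebesgue"
  shows "ennreal I \<le> (\<integral>\<^sup>+t\<in>S. ennreal (f t) \<partial>lebesgue)"
proof (cases "(\<integral>\<^sup>+t\<in>S. ennreal (f t) \<partial>lebesgue) = \<infinity>")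
  case False
  let ?p = "\<lambda>t. if t \<in> S then max 0 (f t) else 0"
  have [measurable]: "(\<lambda>t. if t \<in> S then f t else 0) \<in> borel_measurable lebesgue"
    using has_integral_implies_lebesgue_measurable[OF I]
    by (rule measurable_cong[THEN iffD1, rotated]) (auto simp: indicator_def)
  have m: "?p \<in> borel_measurable lebesgue"
  proof -
    have "?p = (\<lambda>t. max 0 (if t \<in> S then f t else 0))" by auto
    then show ?thesis by simp
  qed
  have eq: "(\<integral>\<^sup>+t\<in>S. ennreal (f t) \<partial>lebesgue) = (\<integral>\<^sup>+t. ennreal (?p t) \<partial>lebesgue)"
    by (intro nn_integral_cong) (auto simp: indicator_def max_def ennreal_neg)
  obtain J where J: "0 \<le> J" "(\<integral>\<^sup>+t\<in>S. ennreal (f t) \<partial>lebesgue) = ennreal J"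
    using False by (cases "(\<integral>\<^sup>+t\<in>S. ennreal (f t) \<partial>lebesgue)") auto
  have "((\<lambda>t. if t \<in> S then f t else 0) has_integral I) UNIV"
    using I by (simp add: has_integral_restrict_UNIV)
  moreover have "(?p has_integral J) UNIV"
    by (rule has_integral_of_nn_integral) (use m J eq in auto)
  ultimately have "I \<le> J"
    by (rule has_integral_le) auto
  then show ?thesis using J by (simp add: ennreal_leI)
qed simp

lemma closed_collisions: "closed (collisions :: (real ^ 'd ^ 'n::finite) set)"
proof -
  have eq: "collisions = (\<Union>p\<in>{p. fst p \<noteq> snd p}. {x :: real ^ 'd ^ 'n. x $ fst p = x $ snd p})"
    by (auto simp: collisions_def) metis
  show ?thesis
    unfolding eq by (intro closed_UN ballI closed_Collect_eq continuous_intros) simp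
qed

lemma borel_measurable_epotential: "epotential \<alpha> m \<in> borel_measurable borel"
proof -
  have [measurable]: "(\<lambda>x :: real ^ 'd ^ 'n. x $ i) \<in> borel_measurable borel" for i
    by (intro borel_measurable_continuous_onI continuous_intros)
  have [measurable]: "potential \<alpha> m \<in> borel_measurable borel"
    unfolding potential_def[abs_def] case_prod_beta by measurable
  have [measurable]: "collisions \<in> sets borel" using closed_collisions by (rule borel_closed)
  show ?thesis unfolding epotential_def[abs_def] by measurable
qed

lemma borel_measurable_mnorm_power2:
  fixes g :: "real \<Rightarrow> real ^ 'd ^ 'n::finite"
  assumes "g absolutely_integrable_on {a..b}"
  shows "(\<lambda>t. (mnorm m (g t))\<^sup>2) \<in> borel_measurable (lebesgue_on {a..b})"
proof -
  have "(\<lambda>t. g t) \<in> borel_measurable (lebesgue_on {a..b})"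
    using assms by (simp add: absolutely_integrable_measurable)
  moreover have "(\<lambda>y. (mnorm m y)\<^sup>2) \<in> borel_measurable borel"
    unfolding mnorm_def by (intro borel_measurable_continuous_onI continuous_intros
       bounded_linear.continuous_on[OF bounded_linear_mass_mult])
  ultimately show ?thesis by (rule measurable_compose)
qed

text \<open>The action does not depend on the choice of the weak derivative.\<close>

lemma action_eq_nn_integral:
  fixes x :: "real \<Rightarrow> real ^ 'd ^ 'n::{finite,linorder}"
  assumes g: "has_weak_derivative x g"
  shows "action \<alpha> m x =
    (\<integral>\<^sup>+t\<in>{0..1}. (ennreal ((mnorm m (g t))\<^sup>2 / 2) + epotential \<alpha> m (x t)) \<partial>lebesgue)"
proof -
  have w: "has_weak_derivative x (weak_derivative x)"
    unfolding weak_derivative_def by (rule someI[of "has_weak_derivative x", OF g])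
  have "AE t in lebesgue. t \<notin> {t \<in> {0..1}. weak_derivative x t \<noteq> g t}"
    using has_weak_derivative_unique[OF w g] unfolding negligible_iff_null_sets by (rule AE_not_in)
  then have ae: "(\<integral>\<^sup>+t\<in>{0..1}. ennreal ((mnorm m (weak_derivative x t))\<^sup>2) \<partial>lebesgue)
    = (\<integral>\<^sup>+t\<in>{0..1}. ennreal ((mnorm m (g t))\<^sup>2) \<partial>lebesgue)"
    by (intro nn_integral_cong_AE) (auto elim!: eventually_mono split: split_indicator)
  have [measurable]: "(\<lambda>t. (mnorm m (g t))\<^sup>2) \<in> borel_measurable (lebesgue_on {0..1})"
    by (rule borel_measurable_mnorm_power2[OF has_weak_derivative_absolutely_integrable[OF g]])
  have [measurable]: "x \<in> borel_measurable (lebesgue_on {0..1})"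
    using has_weak_derivative_continuous[OF g] by (simp add: continuous_imp_measurable_on_sets_lebesgue)
  have [measurable]: "(\<lambda>t. epotential \<alpha> m (x t)) \<in> borel_measurable (lebesgue_on {0..1})"
    by (rule measurable_compose[OF _ borel_measurable_epotential]) measurable
  have res: "(\<integral>\<^sup>+t\<in>{0..1}. f t \<partial>lebesgue) = (\<integral>\<^sup>+t. f t \<partial>lebesgue_on {0..1})" for f :: "real \<Rightarrow> ennreal"
    by (simp add: nn_integral_restrict_space)
  have half: "ennreal (1 / 2) * ennreal y = ennreal (y / 2)" for y
    by (subst ennreal_mult'[symmetric]) auto
  have "action \<alpha> m x = ennreal (1 / 2) * (\<integral>\<^sup>+t\<in>{0..1}. ennreal ((mnorm m (g t))\<^sup>2) \<partial>lebesgue)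
           + (\<integral>\<^sup>+t\<in>{0..1}. epotential \<alpha> m (x t) \<partial>lebesgue)"
    unfolding action_def ae[symmetric] using g by auto
  also have "\<dots> = (\<integral>\<^sup>+t\<in>{0..1}. (ennreal (1 / 2) * ennreal ((mnorm m (g t))\<^sup>2) + epotential \<alpha> m (x t)) \<partial>lebesgue)"
    unfolding res by (subst nn_integral_add) (auto simp: nn_integral_cmult)
  also have "\<dots> = (\<integral>\<^sup>+t\<in>{0..1}. (ennreal ((mnorm m (g t))\<^sup>2 / 2) + epotential \<alpha> m (x t)) \<partial>lebesgue)"
    by (simp only: half)
  finally show ?thesis .
qed

lemma action_has_integral:
  fixes x :: "real \<Rightarrow> real ^ 'd ^ 'n::{finite,linorder}"
  assumes m: "\<And>i. m i > 0" and g: "has_weak_derivative x g"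
    and ncoll: "\<And>t. t \<in> {0..<1} \<Longrightarrow> x t \<notin> collisions"
    and fin: "action \<alpha> m x < \<infinity>"
  obtains A where "A \<ge> 0" "action \<alpha> m x = ennreal A"
    "((\<lambda>t. (mnorm m (g t))\<^sup>2 / 2 + potential \<alpha> m (x t)) has_integral A) {0..1}"
proof -
  let ?L = "\<lambda>t. (mnorm m (g t))\<^sup>2 / 2 + potential \<alpha> m (x t)"
  have Lnn: "?L t \<ge> 0" for t using potential_nonneg[where m = m, OF m, of \<alpha> "x t"] by simp
  have neg: "negligible {1::real}" by simp
  have "AE t in lebesgue. t \<notin> {1::real}"
    using neg unfolding negligible_iff_null_sets by (rule AE_not_in)
  \<comment> \<open>Time \<open>1\<close> is excluded because \<open>epotential\<close> may be infinite there.\<close>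
  then have off1: "AE t in lebesgue. t \<in> {0..1} \<longrightarrow> t \<in> {0..<1::real}" by (auto elim!: eventually_mono)
  have pt: "epotential \<alpha> m (x t) = ennreal (potential \<alpha> m (x t))" if "t \<in> {0..<1}" for t
    using ncoll[OF that] by (simp add: epotential_def)
  have eq: "action \<alpha> m x = (\<integral>\<^sup>+t. ennreal (indicator {0..1} t * ?L t) \<partial>lebesgue)"
    unfolding action_eq_nn_integral[OF g]
  proof (rule nn_integral_cong_AE)
    show "AE t in lebesgue. (ennreal ((mnorm m (g t))\<^sup>2 / 2) + epotential \<alpha> m (x t)) * indicator {0..1} t
        = ennreal (indicator {0..1} t * ?L t)"
      using off1
    proof eventually_elim
      case (elim t)
      then show ?case
        using pt[of t] potential_nonneg[where m = m, OF m, of \<alpha> "x t"]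
        by (cases "t \<in> {0..1}") (simp_all add: ennreal_plus)
    qed
  qed
  obtain A where A: "A \<ge> 0" "action \<alpha> m x = ennreal A"
    using fin by (cases "action \<alpha> m x") auto
  have cont: "continuous_on {0..1} x" using g by (rule has_weak_derivative_continuous)
  have "x \<in> borel_measurable (lebesgue_on {0..1})"
    using cont by (simp add: continuous_imp_measurable_on_sets_lebesgue)
  from borel_measurable_enn2real[OF measurable_compose[OF this borel_measurable_epotential]]
  have "(\<lambda>t. enn2real (epotential \<alpha> m (x t))) \<in> borel_measurable (lebesgue_on {0..1})" .
  moreover have "(\<lambda>t. (mnorm m (g t))\<^sup>2) \<in> borel_measurable (lebesgue_on {0..1})"
    by (rule borel_measurable_mnorm_power2[OF has_weak_derivative_absolutely_integrable[OF g]])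
  ultimately have "(\<lambda>t. (mnorm m (g t))\<^sup>2 / 2 + enn2real (epotential \<alpha> m (x t))) \<in> borel_measurable (lebesgue_on {0..1})"
    by measurable
  then have meas': "(\<lambda>t. indicator {0..1} t *\<^sub>R ((mnorm m (g t))\<^sup>2 / 2 + enn2real (epotential \<alpha> m (x t)))) \<in> borel_measurable lebesgue"
    by (subst (asm) borel_measurable_restrict_space_iff) auto
  have meas: "(\<lambda>t. indicator {0..1} t * ?L t) \<in> borel_measurable lebesgue"
  proof (rule borel_measurable_AE[OF meas'])
    show "AE t in lebesgue. indicator {0..1} t *\<^sub>R ((mnorm m (g t))\<^sup>2 / 2 + enn2real (epotential \<alpha> m (x t)))
        = indicator {0..1} t * ?L t"
      using off1
    proof eventually_elim
      case (elim t)
      then show ?case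
        using pt[of t] potential_nonneg[where m = m, OF m, of \<alpha> "x t"]
        by (cases "t \<in> {0..1}") simp_all
    qed
  qed
  have "((\<lambda>t. indicator {0..1} t * ?L t) has_integral A) UNIV"
  proof (rule has_integral_of_nn_integral[OF meas _ A(1)])
    show "0 \<le> indicator {0..1} t * ?L t" for t by (intro mult_nonneg_nonneg Lnn) simp
    show "(\<integral>\<^sup>+t. ennreal (indicator {0..1} t * ?L t) \<partial>lebesgue) = ennreal A" using A(2) eq by simp
  qed
  then have "((\<lambda>t. if t \<in> {0..1} then ?L t else 0) has_integral A) UNIV"
    by (rule has_integral_eq[rotated]) (auto simp: indicator_def)
  then have "(?L has_integral A) {0..1}" by (simp only: has_integral_restrict_UNIV)
  then show ?thesis using that A by blast
qed

text \<open>The hypothesis \<open>rem\<close> says that the second-order part of the potential is dominated by Hardy's weight, with a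
  constant half as large as the kinetic part allows.\<close>

lemma action_less_of_variation:
  fixes x \<phi> :: "real \<Rightarrow> real ^ 'd ^ 'n::{finite,linorder}"
  assumes m: "\<And>i. m i > 0" and \<alpha>: "\<alpha> > 0" and ab: "0 < a" "a < b" "b < 1"
    and ncoll: "\<And>t. t \<in> {0..<1} \<Longrightarrow> x t \<notin> collisions"
    and x''c: "continuous_on {0<..<1} x''"
    and dx: "\<And>t. t \<in> {0<..<1} \<Longrightarrow> (x has_vector_derivative x' t) (at t)"
    and dx': "\<And>t. t \<in> {0<..<1} \<Longrightarrow> (x' has_vector_derivative x'' t) (at t)"
    and newton: "\<And>t. t \<in> {0<..<1} \<Longrightarrow> GDERIV (potential \<alpha> m) (x t) :> mass_mult m (x'' t)"
    and fin: "action \<alpha> m x < \<infinity>"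
    and rem: "\<And>t (w :: real ^ 'd ^ 'n::{finite,linorder}). t \<in> {a..b} \<Longrightarrow>
      \<alpha> / 2 * (\<Sum>(i, j)\<in>{(i, j). i < j}. m i * m j * (norm (x t $ i - x t $ j) powr (- \<alpha> - 2) * (norm (w $ i - w $ j))\<^sup>2))
      \<le> 1 / 16 * ((mnorm m w)\<^sup>2 / (1 - t)\<^sup>2)"
    and \<phi>: "has_weak_derivative \<phi> g" and g2: "(\<lambda>t. (norm (g t))\<^sup>2) integrable_on {0..1}"
    and \<phi>0: "\<And>t. t \<in> {0..1} \<Longrightarrow> t \<le> a \<or> b \<le> t \<Longrightarrow> \<phi> t = 0"
    and nz: "s \<in> {0..1}" "\<phi> s \<noteq> 0"
  shows "action \<alpha> m x < action \<alpha> m (\<lambda>t. x t + \<phi> t)"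
proof -
  have sub: "{a..b} \<subseteq> {0<..<1}" "{a..b} \<subseteq> {0..1}" using ab by auto
  have x'c: "continuous_on {a..b} x'"
    using dx' sub by (intro continuous_at_imp_continuous_on ballI has_vector_derivative_continuous) blast
  have x''c': "continuous_on {a..b} x''" using x''c sub(1) by (rule continuous_on_subset)
  \<comment> \<open>The weak derivative of \<open>x\<close> is taken to be the classical one on \<open>[a, b]\<close>, that of \<open>\<phi>\<close> to vanish outside
    \<open>[a, b]\<close>; both are changes on null sets.\<close>
  obtain gx where gx: "has_weak_derivative x gx" using fin by (auto simp: action_def split: if_splits)
  have gxi: "gx integrable_on {a..b}"
    using has_weak_derivative_integrable[OF gx] sub(2) by (rule integrable_on_subinterval)
  have x'int: "(x' has_integral x t - x a) {a..t}" if "t \<in> {a..b}" for t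
  proof (rule fundamental_theorem_of_calculus)
    show "(x has_vector_derivative x' r) (at r within {a..t})" if "r \<in> {a..t}" for r
      by (rule has_vector_derivative_at_within, rule dx) (use that \<open>t \<in> {a..b}\<close> ab in auto)
  qed (use that in simp)
  have n1: "negligible {t \<in> {a..b}. gx t - x' t \<noteq> 0}"
  proof (rule indefinite_integral_zero_imp_negligible)
    show "(\<lambda>t. gx t - x' t) integrable_on {a..b}"
      using gxi integrable_continuous_real[OF x'c] by (rule integrable_diff)
    fix t assume t: "t \<in> {a..b}"
    have "gx integrable_on {a..t}" using gxi t by (auto intro: integrable_on_subinterval)
    then have "integral {a..t} (\<lambda>t. gx t - x' t) = integral {a..t} gx - integral {a..t} x'"
      using x'int[OF t] by (intro Henstock_Kurzweil_Integration.integral_diff) auto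
    then show "integral {a..t} (\<lambda>t. gx t - x' t) = 0"
      using has_weak_derivative_increment[OF gx, of a t] x'int[OF t] t ab by (simp add: integral_unique)
  qed
  define G where "G t = (if t \<in> {a..b} then x' t else gx t)" for t
  have G: "has_weak_derivative x G"
    by (rule has_weak_derivative_spike[OF gx], rule negligible_subset[OF n1]) (auto simp: G_def)
  have gi: "g integrable_on {0..1}" using \<phi> by (rule has_weak_derivative_integrable)
  have n2: "negligible {t \<in> {0..a}. g t \<noteq> 0}" and n3: "negligible {t \<in> {b..1}. g t \<noteq> 0}"
  proof -
    show "negligible {t \<in> {0..a}. g t \<noteq> 0}"
    proof (rule indefinite_integral_zero_imp_negligible)
      show "g integrable_on {0..a}" using gi ab by (auto intro: integrable_on_subinterval)
      show "integral {0..t} g = 0" if "t \<in> {0..a}" for t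
        using has_weak_derivative_increment[OF \<phi>, of 0 t] \<phi>0[of 0] \<phi>0[of t] that ab by auto
    qed
    show "negligible {t \<in> {b..1}. g t \<noteq> 0}"
    proof (rule indefinite_integral_zero_imp_negligible)
      show "g integrable_on {b..1}" using gi ab by (auto intro: integrable_on_subinterval)
      show "integral {b..t} g = 0" if "t \<in> {b..1}" for t
        using has_weak_derivative_increment[OF \<phi>, of b t] \<phi>0[of b] \<phi>0[of t] that ab by auto
    qed
  qed
  define k where "k t = (if t \<in> {a..b} then g t else 0)" for t
  have "has_weak_derivative \<phi> k"
    by (rule has_weak_derivative_spike[OF \<phi>], rule negligible_subset[OF negligible_Un[OF n2 n3]])
      (auto simp: k_def)
  then have Gk: "has_weak_derivative (\<lambda>t. x t + \<phi> t) (\<lambda>t. G t + k t)"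
    using G by (intro has_weak_derivative_add)
  let ?L = "\<lambda>t. (mnorm m (G t))\<^sup>2 / 2 + potential \<alpha> m (x t)"
  obtain A where A: "A \<ge> 0" "action \<alpha> m x = ennreal A" and L: "(?L has_integral A) {0..1}"
    by (rule action_has_integral[where m = m, OF m G ncoll fin])
  have gab: "g absolutely_integrable_on {a..b}"
    using has_weak_derivative_absolutely_integrable[OF \<phi>] sub(2) by (rule absolutely_integrable_on_subinterval)
  have \<phi>ab: "\<phi> t = \<phi> a + integral {a..t} g" if "t \<in> {a..b}" for t
    using that ab by (intro has_weak_derivative_increment[OF \<phi>]) auto
  have \<phi>c: "continuous_on {a..b} \<phi>"
    using has_weak_derivative_continuous[OF \<phi>] sub(2) by (rule continuous_on_subset)
  \<comment> \<open>The first variation vanishes, by Newton's equation.\<close>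
  let ?D = "\<lambda>t. mass_mult m (x' t) \<bullet> g t + \<phi> t \<bullet> mass_mult m (x'' t)"
  have D: "(?D has_integral 0) {a..b}"
  proof -
    have Mx': "mass_mult m (x' t) = mass_mult m (x' a) + integral {a..t} (\<lambda>t. mass_mult m (x'' t))"
      if t: "t \<in> {a..b}" for t
    proof -
      have "((\<lambda>t. mass_mult m (x'' t)) has_integral mass_mult m (x' t) - mass_mult m (x' a)) {a..t}"
      proof (rule fundamental_theorem_of_calculus)
        show "((\<lambda>t. mass_mult m (x' t)) has_vector_derivative mass_mult m (x'' r)) (at r within {a..t})"
          if "r \<in> {a..t}" for r
          by (rule has_vector_derivative_at_within,
              rule bounded_linear.has_vector_derivative[OF bounded_linear_mass_mult], rule dx')
            (use that t ab in auto)
      qed (use t in simp)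
      then show ?thesis by (simp add: integral_unique)
    qed
    have Mx'': "(\<lambda>t. mass_mult m (x'' t)) absolutely_integrable_on {a..b}"
      by (intro absolutely_integrable_continuous_real bounded_linear.continuous_on[OF bounded_linear_mass_mult] x''c')
    note ibp = integration_by_parts_AC[OF less_imp_le[OF ab(2)] Mx'' gab Mx' \<phi>ab]
    have "integral {a..b} ?D = 0" using ibp(2) \<phi>0[of a] \<phi>0[of b] ab by simp
    moreover have "?D integrable_on {a..b}" using ibp(1) by (rule set_lebesgue_integral_eq_integral(1))
    ultimately show ?thesis by (simp add: has_integral_iff)
  qed
  let ?q = "\<lambda>t. (mnorm m (\<phi> t))\<^sup>2 / (1 - t)\<^sup>2"
  have g2ab: "(\<lambda>t. (mnorm m (g t))\<^sup>2) integrable_on {a..b}"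
  proof -
    obtain B where B: "\<And>y. norm (mass_mult m y :: real ^ 'd ^ 'n::{finite,linorder}) \<le> norm y * B"
      using bounded_linear.bounded[OF bounded_linear_mass_mult] by blast
    show ?thesis
    proof (rule measurable_bounded_by_integrable_imp_integrable)
      show "(\<lambda>t. (mnorm m (g t))\<^sup>2) \<in> borel_measurable (lebesgue_on {a..b})"
        by (rule borel_measurable_mnorm_power2[OF gab])
      have "(\<lambda>t. (norm (g t))\<^sup>2) integrable_on {a..b}" using g2 sub(2) by (rule integrable_on_subinterval)
      then show "(\<lambda>t. B * (norm (g t))\<^sup>2) integrable_on {a..b}" by (rule integrable_on_mult_right)
      fix t assume "t \<in> {a..b}"
      have "(mnorm m (g t))\<^sup>2 \<le> norm (mass_mult m (g t)) * norm (g t)"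
        unfolding mnorm_power2[where m = m, OF m] by (rule norm_cauchy_schwarz)
      also have "\<dots> \<le> norm (g t) * B * norm (g t)" by (intro mult_right_mono B) simp
      finally show "norm ((mnorm m (g t))\<^sup>2) \<le> B * (norm (g t))\<^sup>2" by (simp add: power2_eq_square mult_ac)
    qed simp
  qed
  have hardy: "?q integrable_on {a..b}"
      "integral {a..b} ?q \<le> 4 * integral {a..b} (\<lambda>t. (mnorm m (g t))\<^sup>2)"
    using Hardy_inequality[where m = m, OF m less_imp_le[OF ab(2)] ab(3) gab g2ab \<phi>ab] \<phi>0[of a] \<phi>0[of b] ab by auto
  have qpos: "integral {a..b} ?q > 0"
  proof -
    have qc: "continuous_on {a..b} ?q"
      unfolding mnorm_power2[where m = m, OF m]
      using ab by (intro continuous_intros mass_inner_continuous \<phi>c) auto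
    have s: "s \<in> {a..b}" using nz \<phi>0[of s] by force
    have "integral {a..b} ?q \<noteq> 0"
    proof
      assume "integral {a..b} ?q = 0"
      then have "?q s = 0" using integral_eq_0_iff[OF qc] ab s by simp
      then show False using s ab nz(2) mnorm_eq_0[where m = m, OF m, of "\<phi> s"] by simp
    qed
    moreover have "integral {a..b} ?q \<ge> 0" using hardy(1) by (rule integral_nonneg) simp
    ultimately show ?thesis by simp
  qed
  let ?E = "\<lambda>t. (mnorm m (g t))\<^sup>2 / 2 - 1 / 16 * ?q t"
  define e where "e = integral {a..b} (\<lambda>t. (mnorm m (g t))\<^sup>2) / 2 - 1 / 16 * integral {a..b} ?q"
  have E: "(?E has_integral e) {a..b}"
    unfolding e_def
    by (intro has_integral_diff has_integral_mult_right has_integral_divide integrable_integral g2ab hardy(1))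
  \<comment> \<open>Hardy bounds the first integral below by \<open>1/8\<close> of the second.\<close>
  have e: "e > 0" using hardy(2) qpos by (simp add: e_def)
  \<comment> \<open>\<open>?R\<close> is a pointwise lower bound for the Lagrangian of \<open>x + \<phi>\<close>, also where \<open>x + \<phi>\<close> collides.\<close>
  let ?R = "\<lambda>t. ?L t + (if t \<in> {a..b} then ?D t + ?E t else 0)"
  have "((\<lambda>t. if t \<in> {a..b} then ?D t + ?E t else 0) has_integral 0 + e) {0..1}"
    using has_integral_add[OF D E] sub(2) by (simp only: has_integral_restrict)
  then have R: "(?R has_integral A + e) {0..1}"
    using has_integral_add[OF L] by fastforce
  have point: "ennreal (?R t) \<le> ennreal ((mnorm m (G t + k t))\<^sup>2 / 2) + epotential \<alpha> m (x t + \<phi> t)"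
    if t: "t \<in> {0..<1}" for t
  proof (cases "x t + \<phi> t \<in> collisions")
    case True
    then show ?thesis by (simp add: epotential_def)
  next
    case False
    have "?R t \<le> (mnorm m (G t + k t))\<^sup>2 / 2 + potential \<alpha> m (x t + \<phi> t)"
    proof (cases "t \<in> {a..b}")
      case False
      then have "\<phi> t = 0" "k t = 0" using t \<phi>0[of t] by (auto simp: k_def)
      moreover have "?R t = ?L t" using False by (simp only: if_False add_0_right)
      ultimately show ?thesis by simp
    next
      case True
      then have t': "t \<in> {0<..<1}" using sub by auto
      have "potential \<alpha> m (x t) + mass_mult m (x'' t) \<bullet> \<phi> t - 1 / 16 * ?q t \<le> potential \<alpha> m (x t + \<phi> t)"
        using potential_above_tangent[where m = m, OF m ncoll[OF t] False \<alpha>] rem[OF True, of "\<phi> t"]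
          potential_gradient_inner[OF ncoll[OF t] newton[OF t'], of "\<phi> t"] by linarith
      moreover have "(mnorm m (x' t + g t))\<^sup>2 = (mnorm m (x' t))\<^sup>2 + 2 * (mass_mult m (x' t) \<bullet> g t) + (mnorm m (g t))\<^sup>2"
        unfolding mnorm_power2[where m = m, OF m]
        using mass_inner_commute[of m "g t" "x' t"]
        by (simp add: linear_add[OF linear_mass_mult] inner_add_left inner_add_right)
      ultimately show ?thesis using True by (simp add: G_def k_def inner_commute[of "\<phi> t"] add_divide_distrib)
    qed
    then have "ennreal (?R t) \<le> ennreal ((mnorm m (G t + k t))\<^sup>2 / 2 + potential \<alpha> m (x t + \<phi> t))"
      by (rule ennreal_leI)
    also have "\<dots> = ennreal ((mnorm m (G t + k t))\<^sup>2 / 2) + epotential \<alpha> m (x t + \<phi> t)"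
      using False potential_nonneg[where m = m, OF m, of \<alpha> "x t + \<phi> t"] by (simp add: epotential_def ennreal_plus)
    finally show ?thesis .
  qed
  have neg: "negligible {1::real}" by simp
  have ae1: "AE t in lebesgue. t \<notin> {1::real}"
    using neg unfolding negligible_iff_null_sets by (rule AE_not_in)
  have "ennreal A < ennreal (A + e)" using A(1) e by (simp add: ennreal_less_iff)
  also have "\<dots> \<le> (\<integral>\<^sup>+t\<in>{0..1}. ennreal (?R t) \<partial>lebesgue)"
    by (rule ennreal_integral_le_nn_integral[OF R]) simp
  also have "\<dots> \<le> (\<integral>\<^sup>+t\<in>{0..1}. (ennreal ((mnorm m (G t + k t))\<^sup>2 / 2) + epotential \<alpha> m (x t + \<phi> t)) \<partial>lebesgue)"
  proof (rule nn_integral_mono_AE)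
    show "AE t in lebesgue. ennreal (?R t) * indicator {0..1} t
        \<le> (ennreal ((mnorm m (G t + k t))\<^sup>2 / 2) + epotential \<alpha> m (x t + \<phi> t)) * indicator {0..1} t"
      using ae1
    proof eventually_elim
      case (elim t)
      then show ?case using point[of t] by (cases "t \<in> {0..1}") auto
    qed
  qed
  also have "\<dots> = action \<alpha> m (\<lambda>t. x t + \<phi> t)"
    by (rule action_eq_nn_integral[OF Gk, symmetric])
  finally show ?thesis using A(2) by simp
qed

section \<open>Asymptotic minimality\<close>

text \<open>Replacing body \<open>i\<close> of the shape by body \<open>j\<close> gives a collision, at distance \<open>\<surd>m\<^sub>i \<bar>s\<^sub>i - s\<^sub>j\<bar>\<close> from the shape.\<close>

lemma asymptotic_separation:
  fixes m :: "'n::finite \<Rightarrow> real" and x :: "real \<Rightarrow> real ^ 'd ^ 'n::finite"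
  assumes m: "\<And>i. m i > 0" and \<delta>: "\<delta> > 0"
    and K: "K \<inter> collisions_nbhd m \<delta> = {}" and asym: "asymptotic_to m K x"
    and nz: "\<forall>\<^sub>F t in at_left 1. x t \<noteq> 0"
  shows "\<forall>\<^sub>F t in at_left 1. \<forall>i j. i \<noteq> j \<longrightarrow>
    \<delta> / (2 * sqrt (sum m UNIV)) * mnorm m (x t) \<le> norm (x t $ i - x t $ j)"
proof -
  have "\<forall>\<^sub>F t in at_left 1. (INF k\<in>K. ereal (mnorm m (shape m (x t) - k))) < ereal (\<delta> / 2)"
    using asym \<delta> unfolding asymptotic_to_def by (intro order_tendstoD) (auto simp: zero_ereal_def)
  then show ?thesis
    using nz
  proof eventually_elim
    case (elim t)
    show ?case
    proof (intro allI impI)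
      fix i j :: 'n assume ij: "i \<noteq> j"
      define s where "s = shape m (x t)"
      obtain k where k: "k \<in> K" "mnorm m (s - k) < \<delta> / 2"
        using elim(1) unfolding s_def INF_less_iff by auto
      define y where "y = (\<chi> l. if l = i then s $ j else s $ l)"
      have "y $ i = y $ j" by (simp add: y_def)
      then have "y \<in> collisions" using ij unfolding collisions_def by blast
      then have "\<not> mnorm m (k - y) < \<delta>"
        using k(1) K unfolding collisions_nbhd_def by blast
      then have far: "\<delta> \<le> mnorm m (k - y)" by simp
      have "(mnorm m (s - y))\<^sup>2 = (\<Sum>l\<in>UNIV. if l = i then m i * (norm (s $ i - s $ j))\<^sup>2 else 0)"
        unfolding mnorm_power2[where m = m, OF m] mass_inner_eq_sum
        by (intro sum.cong) (auto simp: y_def power2_norm_eq_inner)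
      also have "\<dots> = m i * (norm (s $ i - s $ j))\<^sup>2" by simp
      also have "\<dots> \<le> sum m UNIV * (norm (s $ i - s $ j))\<^sup>2"
        using m[THEN less_imp_le] by (intro mult_right_mono member_le_sum) auto
      also have "\<dots> = (sqrt (sum m UNIV) * norm (s $ i - s $ j))\<^sup>2"
        using m[THEN less_imp_le] by (simp add: power_mult_distrib sum_nonneg)
      finally have near: "mnorm m (s - y) \<le> sqrt (sum m UNIV) * norm (s $ i - s $ j)"
        by (rule power2_le_imp_le)
          (use m[THEN less_imp_le] in \<open>auto intro!: mult_nonneg_nonneg sum_nonneg\<close>)
      have "mnorm m (k - y) \<le> mnorm m (k - s) + mnorm m (s - y)"
        using mnorm_triangle[where m = m, OF m, of "k - s" "s - y"] by simp
      then have half: "\<delta> / 2 \<le> sqrt (sum m UNIV) * norm (s $ i - s $ j)"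
        using far near k(2) mnorm_minus_commute[where m = m, OF m, of k s] by linarith
      have r: "mnorm m (x t) > 0" using mnorm_pos[where m = m, OF m] elim(2) by blast
      have sm: "sqrt (sum m UNIV) > 0" using m by (simp add: sum_pos)
      have "norm (s $ i - s $ j) = norm (x t $ i - x t $ j) / mnorm m (x t)"
        using r by (simp add: s_def shape_def divide_inverse_commute flip: scaleR_diff_right)
      with half r sm show "\<delta> / (2 * sqrt (sum m UNIV)) * mnorm m (x t) \<le> norm (x t $ i - x t $ j)"
        by (simp add: field_simps)
    qed
  qed
qed

theorem theorem6p6:
  fixes m :: "'n::{finite,linorder} \<Rightarrow> real"
    and A :: "real set"
    and K :: "real \<Rightarrow> (real ^ 'd ^ 'n::{finite,linorder}) set"
  assumes "CARD('d) \<ge> 2" and "CARD('n) \<ge> 2"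
    and "\<And>i. m i > 0"
    and "A \<subseteq> {0<..<2}"
    and "\<And>\<alpha>. \<alpha> \<in> A \<Longrightarrow> K \<alpha> \<subseteq> central_configurations \<alpha> m"
    and "\<exists>\<delta>>0. \<forall>\<alpha>\<in>A. K \<alpha> \<subseteq> central_configurations \<alpha> m - collisions_nbhd m \<delta>"
  shows "\<exists>\<alpha>bar\<in>{0<..<2}. \<forall>\<alpha>\<in>{0<..<\<alpha>bar} \<inter> A. asymptotically_minimal \<alpha> m (K \<alpha>)"
proof -
  note card = assms(2) and m = assms(3)
  obtain \<delta> where \<delta>: "\<delta> > 0" and far: "\<And>\<alpha>. \<alpha> \<in> A \<Longrightarrow> K \<alpha> \<inter> collisions_nbhd m \<delta> = {}"
    using assms(6) by blast
  define c where "c = \<delta> / (2 * sqrt (sum m UNIV))"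
  have c: "c > 0" using m \<delta> by (simp add: c_def sum_pos)
  obtain b where b: "b > 0" and lower: "\<And>\<alpha> y. \<alpha> \<in> {0<..1} \<Longrightarrow> (y :: real ^ 'd ^ 'n::{finite,linorder}) \<notin> collisions \<Longrightarrow>
      b * mnorm m y powr (- \<alpha>) \<le> potential \<alpha> m y"
    using potential_lower_bound[where m = m and 'd = 'd, OF m card] by blast
  obtain C where C: "C > 0"
    and rem: "\<And>\<alpha> (x :: real ^ 'd ^ 'n::{finite,linorder}) (w :: real ^ 'd ^ 'n::{finite,linorder}).
      \<alpha> \<in> {0<..1} \<Longrightarrow> mnorm m x > 0 \<Longrightarrow>
      \<forall>i j. i \<noteq> j \<longrightarrow> c * mnorm m x \<le> norm (x $ i - x $ j) \<Longrightarrow>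
      (\<Sum>(i, j)\<in>{(i, j). i < j}. m i * m j * (norm (x $ i - x $ j) powr (- \<alpha> - 2) * (norm (w $ i - w $ j))\<^sup>2))
       \<le> C * mnorm m x powr (- \<alpha> - 2) * (mnorm m w)\<^sup>2"
    by (rule pair_sum_bound[where m = m, OF m c]) (rule that; assumption)
  \<comment> \<open>Below \<open>b / (8 C)\<close> the remainder \<open>\<alpha> / 2 * C\<close> is at most \<open>b / 16\<close>; the minimum with \<open>1\<close> is due to the range
    of \<open>\<alpha>\<close> in which \<open>b\<close> and \<open>C\<close> are valid.\<close>
  define \<alpha>bar where "\<alpha>bar = min 1 (b / (8 * C))"
  have "\<alpha>bar \<in> {0<..<2}" using b C by (auto simp: \<alpha>bar_def)
  moreover have "asymptotically_minimal \<alpha> m (K \<alpha>)" if "\<alpha> \<in> {0<..<\<alpha>bar} \<inter> A" for \<alpha>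
  proof -
    have \<alpha>: "\<alpha> \<in> {0<..1}" "\<alpha> > 0" "\<alpha> \<in> A" "\<alpha> / 2 * C \<le> b / 16"
      using that C by (auto simp: \<alpha>bar_def field_simps)
    show ?thesis
      unfolding asymptotically_minimal_def
    proof (intro conjI allI impI, rule assms(5)[OF \<alpha>(3)], elim conjE)
      fix x assume sol: "total_collision_solution \<alpha> m x" and asym: "asymptotic_to m (K \<alpha>) x"
      from sol obtain x' x'' where
        ncoll: "\<And>t. t \<in> {0..<1} \<Longrightarrow> x t \<notin> collisions"
        and x''c: "continuous_on {0<..<1} x''"
        and dx: "\<And>t. t \<in> {0<..<1} \<Longrightarrow> (x has_vector_derivative x' t) (at t)"
        and dx': "\<And>t. t \<in> {0<..<1} \<Longrightarrow> (x' has_vector_derivative x'' t) (at t)"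
        and newton: "\<And>t. t \<in> {0<..<1} \<Longrightarrow> GDERIV (potential \<alpha> m) (x t) :> mass_mult m (x'' t)"
        and fin: "action \<alpha> m x < \<infinity>"
        unfolding total_collision_solution_def by blast
      have nz: "x t \<noteq> 0" if "t \<in> {0..<1}" for t
        using ncoll[OF that] zero_in_collisions[OF card] by auto
      have "\<forall>\<^sub>F t in at_left 1. t \<in> {0..<1::real}"
        unfolding eventually_at_left[of 0, OF zero_less_one] by (intro exI[of _ 0]) auto
      then have "\<forall>\<^sub>F t in at_left 1. x t \<noteq> 0" by eventually_elim (rule nz)
      from asymptotic_separation[where m = m, OF m \<delta> far[OF \<alpha>(3)] asym this]
        total_collision_lower_rate[where m = m, OF card m \<alpha>(1) b lower[OF \<alpha>(1)] sol]
      have "\<forall>\<^sub>F t in at_left 1. (\<forall>i j. i \<noteq> j \<longrightarrow> c * mnorm m (x t) \<le> norm (x t $ i - x t $ j)) \<and>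
          b * (1 - t)\<^sup>2 \<le> mnorm m (x t) powr (\<alpha> + 2)"
        unfolding c_def by (rule eventually_conj)
      then obtain \<tau>0 where \<tau>0: "\<tau>0 < 1" "\<And>t. \<tau>0 < t \<Longrightarrow> t < 1 \<Longrightarrow>
          (\<forall>i j. i \<noteq> j \<longrightarrow> c * mnorm m (x t) \<le> norm (x t $ i - x t $ j)) \<and>
          b * (1 - t)\<^sup>2 \<le> mnorm m (x t) powr (\<alpha> + 2)"
        unfolding eventually_at_left[of 0, OF zero_less_one] by blast
      define \<tau> where "\<tau> = max \<tau>0 (1 / 2)"
      have \<tau>: "\<tau> \<in> {0<..<1}" "\<tau>0 \<le> \<tau>" using \<tau>0(1) by (auto simp: \<tau>_def)
      have small: "\<alpha> / 2 * (\<Sum>(i, j)\<in>{(i, j). i < j}. m i * m j * (norm (x t $ i - x t $ j) powr (- \<alpha> - 2) * (norm (w $ i - w $ j))\<^sup>2))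
          \<le> 1 / 16 * ((mnorm m w)\<^sup>2 / (1 - t)\<^sup>2)" if t: "\<tau> < t" "t < 1" for t and w :: "real ^ 'd ^ 'n::{finite,linorder}"
      proof -
        have t': "t \<in> {0..<1}" using t \<tau> by auto
        have r: "mnorm m (x t) > 0" using mnorm_pos[where m = m, OF m] nz[OF t'] by blast
        have sep: "\<forall>i j. i \<noteq> j \<longrightarrow> c * mnorm m (x t) \<le> norm (x t $ i - x t $ j)"
          and rate: "b * (1 - t)\<^sup>2 \<le> mnorm m (x t) powr (\<alpha> + 2)"
          using \<tau>0(2)[of t] t \<tau> by auto
        have "b * mnorm m (x t) powr (- (\<alpha> + 2)) \<le> 1 / (1 - t)\<^sup>2"
          using rate r t by (simp only: powr_minus_divide) (simp add: field_simps)
        moreover have "- (\<alpha> + 2) = - \<alpha> - 2" by simp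
        ultimately have rate': "b * mnorm m (x t) powr (- \<alpha> - 2) \<le> 1 / (1 - t)\<^sup>2" by metis
        have "\<alpha> / 2 * (\<Sum>(i, j)\<in>{(i, j). i < j}. m i * m j * (norm (x t $ i - x t $ j) powr (- \<alpha> - 2) * (norm (w $ i - w $ j))\<^sup>2))
            \<le> \<alpha> / 2 * (C * mnorm m (x t) powr (- \<alpha> - 2) * (mnorm m w)\<^sup>2)"
          using \<alpha>(2) by (intro mult_left_mono rem[OF \<alpha>(1) r sep]) simp
        also have "\<dots> = \<alpha> / 2 * C * (mnorm m (x t) powr (- \<alpha> - 2) * (mnorm m w)\<^sup>2)" by (simp add: mult_ac)
        also have "\<dots> \<le> b / 16 * (mnorm m (x t) powr (- \<alpha> - 2) * (mnorm m w)\<^sup>2)"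
          using \<alpha>(4) by (rule mult_right_mono) simp
        also have "\<dots> = 1 / 16 * (b * mnorm m (x t) powr (- \<alpha> - 2)) * (mnorm m w)\<^sup>2" by (simp add: mult_ac)
        also have "\<dots> \<le> 1 / 16 * (1 / (1 - t)\<^sup>2) * (mnorm m w)\<^sup>2"
          using rate' by (intro mult_right_mono mult_left_mono) auto
        finally show ?thesis by simp
      qed
      show "\<exists>\<tau>\<in>{0<..<1}. \<forall>\<phi>. compact_variation \<alpha> m x \<tau> 1 \<phi> \<and> (\<exists>t\<in>{0..1}. \<phi> t \<noteq> 0) \<longrightarrow>
           action \<alpha> m x < action \<alpha> m (\<lambda>t. x t + \<phi> t)"
      proof (intro bexI[OF _ \<tau>(1)] allI impI, elim conjE bexE)
        fix \<phi> s assume var: "compact_variation \<alpha> m x \<tau> 1 \<phi>" and s: "s \<in> {0..1}" "\<phi> s \<noteq> 0"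
        let ?S = "closure {t \<in> {0..1}. \<phi> t \<noteq> 0}"
        obtain g where g: "has_weak_derivative \<phi> g" "(\<lambda>t. (norm (g t))\<^sup>2) integrable_on {0..1}"
          and supp: "?S \<subseteq> {\<tau><..<1}"
          using var unfolding compact_variation_def H1_def by blast
        have sub: "{t \<in> {0..1}. \<phi> t \<noteq> 0} \<subseteq> ?S" by (rule closure_subset)
        have S: "compact ?S" "?S \<noteq> {}"
          using s sub by (auto intro: bounded_subset[of "{0..1}"])
        obtain p where p: "p \<in> ?S" "\<And>t. t \<in> ?S \<Longrightarrow> p \<le> t"
          using compact_attains_inf[OF S] by blast
        obtain q where q: "q \<in> ?S" "\<And>t. t \<in> ?S \<Longrightarrow> t \<le> q"
          using compact_attains_sup[OF S] by blast
        have pq: "\<tau> < p" "p \<le> q" "q < 1" using p q supp by auto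
        define a where "a = (\<tau> + p) / 2"
        define b' where "b' = (q + 1) / 2"
        have ab: "\<tau> < a" "a < p" "q < b'" "b' < 1" using pq by (auto simp: a_def b'_def)
        show "action \<alpha> m x < action \<alpha> m (\<lambda>t. x t + \<phi> t)"
        proof (rule action_less_of_variation[where a = a and b = b', OF m \<alpha>(2) _ _ _ ncoll x''c dx dx' newton fin small g])
          show "0 < a" "a < b'" "b' < 1" using ab pq \<tau> by auto
          show "s \<in> {0..1}" "\<phi> s \<noteq> 0" by fact+
          show "\<tau> < t" "t < 1" if "t \<in> {a..b'}" for t using that ab by auto
          show "\<phi> t = 0" if "t \<in> {0..1}" "t \<le> a \<or> b' \<le> t" for t
          proof (rule ccontr)
            assume "\<phi> t \<noteq> 0"
            then have "t \<in> ?S" using that sub by blast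
            then show False using p(2)[of t] q(2)[of t] that ab by linarith
          qed
        qed
      qed
    qed
  qed
  ultimately show ?thesis by blast
qed

end
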